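(* Under the balanced goal distribution $p^a_1=p^a_2=\dots=p^a_k=\frac1k$, all policies $\pi\in\Pi_{\text{success}}(\mathcal P)=\{\pi:R(\pi;\mathcal P)=1\}$ have the same expected path length $H^\pi(\mathcal P)$.
   Context: **Environment.** $k\ge2$, $L\ge2$, $N\ge\frac{k^{L+1}-1}{k-1}$, $[n]=\{1,\dots,n\}$. A full $k$-ary tree is a rooted tree in which each node has either $k$ (ordered, indexed $1,\dots,k$) children or none; its nodes are distinct elements of $[N]$; depth is the maximal distance from the root to a leaf. An environment is $\Phi=(\mathcal T,g(\mathcal T))$ with $g(\mathcal T)$ a leaf (the goal), not shown to the agent. The agent starts at the root $n_1$. At step $h$ it is at node $n_h$ and picks $a_h\in\{\mathrm{down}_1,\dots,\mathrm{down}_k,\mathrm{up}\}$ ($\mathrm{up}$: go to the parent; $\mathrm{down}_i$: go to the $i$-th child). An action is illegal if it is $\mathrm{up}$ at the root, or $\mathrm{down}_i$ at a leaf, or has already been taken at $n_h$ earlier in the episode. A legal action moves the agent deterministically to $n_{h+1}$. The agent observes $o_h=(n_h,c_h)$ with $c_h=0$ if $n_h$ is not a leaf, $c_h=\times$ if $n_h$ is a leaf other than the goal, $c_h=\checkmark$ if $n_h$ is the goal. The episode ends when $c_h=\checkmark$ (success) or an illegal action is taken; the maximum length is $H=2N$. The state is the history $s_h=(o_1,a_1,\dots,o_{h-1},a_{h-1},o_h)$, and a policy $\pi$ maps each state to a probability distribution over actions. **Environment distribution.** For $l\in[L]$ let $p^l_{\text{env,tree}}$ be the uniform distribution on all full $k$-ary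 trees with distinct nodes in $[N]$ and depth $l$. Given $\mathcal T$, the goal is the leaf reached by starting at the root and repeatedly moving to the $i$-th child with probability $p^a_i$, independently at each node, until a leaf is reached; the induced law is $p^a(\cdot\mid\mathcal T)$. The environment distribution is $\mathcal P(\mathcal T,g)=\big(\sum_{l=1}^L\omega_l\,p^l_{\text{env,tree}}(\mathcal T)\big)\,p^a(g\mid\mathcal T)$ with weights $\omega_l>0$, $\sum_{l=1}^L\omega_l=1$. $R(\pi;\mathcal P)$ is the probability that $\pi$ reaches the goal when $\Phi\sim\mathcal P$. For $\pi\in\Pi_{\text{success}}(\mathcal P)$, $H^\pi(\mathcal P)$ is the expected number of steps (actions taken) until the goal is reached when $\Phi\sim\mathcal P$. *)

theory Defs
  imports "HOL-Probability.Probability_Mass_Function"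
begin

text \<open>
  Trees are ordered and carry their node names as labels. In the trees considered below all labels
  are distinct, so a node is identified with its label; child indices run from 1 to \<open>k\<close>.
\<close>

datatype ktree = Node (label: nat) (children: "ktree list")

fun labels :: "ktree \<Rightarrow> nat list" where
  "labels (Node n ts) = n # concat (map labels ts)"

fun full :: "nat \<Rightarrow> ktree \<Rightarrow> bool" where
  "full k (Node n ts) \<longleftrightarrow> (ts = [] \<or> length ts = k) \<and> (\<forall>t\<in>set ts. full k t)"

fun depth :: "ktree \<Rightarrow> nat" where
  "depth (Node n ts) = (if ts = [] then 0 else Suc (Max (depth ` set ts)))"

definition full_trees :: "nat \<Rightarrow> nat \<Rightarrow> nat \<Rightarrow> ktree set" where
  "full_trees k N l =
     {T. full k T \<and> distinct (labels T) \<and> set (labels T) \<subseteq> {1..N} \<and> depth T = l}"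

fun subtrees :: "ktree \<Rightarrow> ktree set" where
  "subtrees (Node n ts) = insert (Node n ts) (\<Union>t\<in>set ts. subtrees t)"

definition is_leaf :: "ktree \<Rightarrow> nat \<Rightarrow> bool" where
  "is_leaf T n \<longleftrightarrow> Node n [] \<in> subtrees T"

definition is_child :: "ktree \<Rightarrow> nat \<Rightarrow> nat \<Rightarrow> nat \<Rightarrow> bool" where
  "is_child T n i m \<longleftrightarrow>
     (\<exists>ts. Node n ts \<in> subtrees T \<and> i \<in> {1..length ts} \<and> m = label (ts ! (i - 1)))"


text \<open>
  The distribution on \<open>{1..n}\<close> with weights \<open>w 1, \<dots>, w n\<close>. It is meaningful only if these are
  nonnegative and sum to 1.
\<close>

definition weights_pmf :: "nat \<Rightarrow> (nat \<Rightarrow> real) \<Rightarrow> nat pmf" where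
  "weights_pmf n w = embed_pmf (\<lambda>i. if i \<in> {1..n} then w i else 0)"

lemma pmf_weights_pmf:
  assumes "\<And>i. i \<in> {1..n} \<Longrightarrow> 0 \<le> w i" and "(\<Sum>i\<in>{1..n}. w i) = 1"
  shows "pmf (weights_pmf n w) i = (if i \<in> {1..n} then w i else 0)"
proof -
  have "(\<integral>\<^sup>+ i. ennreal (if i \<in> {1..n} then w i else 0) \<partial>count_space UNIV)
      = (\<Sum>i\<in>{1..n}. ennreal (w i))"
    by (subst nn_integral_count_space'[where A = "{1..n}"]) (auto intro!: sum.cong)
  also have "\<dots> = ennreal (\<Sum>i\<in>{1..n}. w i)"
    using assms(1) by (intro sum_ennreal) auto
  finally show ?thesis
    unfolding weights_pmf_def using assms by (subst pmf_embed_pmf) auto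
qed

primrec goal_pmf :: "nat \<Rightarrow> (nat \<Rightarrow> real) \<Rightarrow> ktree \<Rightarrow> nat pmf" where
  "goal_pmf k p (Node n ts) =
     (if ts = [] then return_pmf n
      else bind_pmf (weights_pmf k p) (\<lambda>i. map (goal_pmf k p) ts ! (i - 1)))"

definition env_pmf ::
  "nat \<Rightarrow> nat \<Rightarrow> nat \<Rightarrow> (nat \<Rightarrow> real) \<Rightarrow> (nat \<Rightarrow> real) \<Rightarrow> (ktree \<times> nat) pmf" where
  "env_pmf k L N \<omega> p =
     bind_pmf (weights_pmf L \<omega>) (\<lambda>l.
     bind_pmf (pmf_of_set (full_trees k N l)) (\<lambda>T.
     map_pmf (Pair T) (goal_pmf k p T)))"


datatype action = Up | Down nat

text \<open>The three marks stand for \<open>c\<^sub>h = 0\<close>, \<open>c\<^sub>h = \<times>\<close> and \<open>c\<^sub>h = \<checkmark>\<close>.\<close>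

datatype mark = Inner | Wrong_Leaf | Goal

type_synonym obs = "nat \<times> mark"

text \<open>
  The history \<open>(o\<^sub>1, a\<^sub>1, \<dots>, o\<^sub>h\<^sub>-\<^sub>1, a\<^sub>h\<^sub>-\<^sub>1, o\<^sub>h)\<close> is represented as
  \<open>([(o\<^sub>1, a\<^sub>1), \<dots>, (o\<^sub>h\<^sub>-\<^sub>1, a\<^sub>h\<^sub>-\<^sub>1)], o\<^sub>h)\<close>.
\<close>

type_synonym history = "(obs \<times> action) list \<times> obs"

type_synonym policy = "history \<Rightarrow> action pmf"

definition policies :: "nat \<Rightarrow> policy set" where
  "policies k = {\<pi>. \<forall>s. set_pmf (\<pi> s) \<subseteq> insert Up (Down ` {1..k})}"

definition observe :: "ktree \<Rightarrow> nat \<Rightarrow> nat \<Rightarrow> obs" where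
  "observe T g n =
     (n, if \<not> is_leaf T n then Inner else if n = g then Goal else Wrong_Leaf)"

definition current_node :: "history \<Rightarrow> nat" where
  "current_node s = fst (snd s)"

definition at_goal :: "history \<Rightarrow> bool" where
  "at_goal s \<longleftrightarrow> snd (snd s) = Goal"

definition num_steps :: "history \<Rightarrow> nat" where
  "num_steps s = length (fst s)"

definition taken :: "history \<Rightarrow> action \<Rightarrow> bool" where
  "taken s a \<longleftrightarrow> (\<exists>c. ((current_node s, c), a) \<in> set (fst s))"

definition illegal :: "ktree \<Rightarrow> history \<Rightarrow> action \<Rightarrow> bool" where
  "illegal T s a \<longleftrightarrow>
     (a = Up \<and> current_node s = label T) \<or>
     (\<exists>i. a = Down i \<and> is_leaf T (current_node s)) \<or>
     taken s a"

fun move :: "ktree \<Rightarrow> nat \<Rightarrow> action \<Rightarrow> nat" where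
  "move T n Up = (THE m. \<exists>i. is_child T m i n)"
| "move T n (Down i) = (THE m. is_child T n i m)"

definition init_history :: "ktree \<Rightarrow> nat \<Rightarrow> history" where
  "init_history T g = ([], observe T g (label T))"

definition next_history :: "ktree \<Rightarrow> nat \<Rightarrow> history \<Rightarrow> action \<Rightarrow> history" where
  "next_history T g s a =
     (fst s @ [(snd s, a)], observe T g (move T (current_node s) a))"

text \<open>
  The law of the final history of an episode continued from \<open>s\<close> with at most the given number of
  further actions. An illegal action ends the episode and is not recorded in the history.
\<close>

fun rollout :: "policy \<Rightarrow> ktree \<Rightarrow> nat \<Rightarrow> nat \<Rightarrow> history \<Rightarrow> history pmf" where
  "rollout \<pi> T g 0 s = return_pmf s"
| "rollout \<pi> T g (Suc h) s =
     (if at_goal s then return_pmf s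
      else bind_pmf (\<pi> s) (\<lambda>a.
        if illegal T s a then return_pmf s
        else rollout \<pi> T g h (next_history T g s a)))"

definition episode_pmf :: "nat \<Rightarrow> (ktree \<times> nat) pmf \<Rightarrow> policy \<Rightarrow> history pmf" where
  "episode_pmf N P \<pi> =
     bind_pmf P (\<lambda>(T, g). rollout \<pi> T g (2 * N) (init_history T g))"

definition success_prob :: "nat \<Rightarrow> (ktree \<times> nat) pmf \<Rightarrow> policy \<Rightarrow> real" where
  "success_prob N P \<pi> = measure_pmf.prob (episode_pmf N P \<pi>) {s. at_goal s}"

definition success_policies :: "nat \<Rightarrow> nat \<Rightarrow> (ktree \<times> nat) pmf \<Rightarrow> policy set" where
  "success_policies k N P = {\<pi> \<in> policies k. success_prob N P \<pi> = 1}"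

text \<open>
  Used only for policies with success probability 1, for which almost surely the episode ends
  exactly when the goal is reached.
\<close>

definition expected_steps :: "nat \<Rightarrow> (ktree \<times> nat) pmf \<Rightarrow> policy \<Rightarrow> real" where
  "expected_steps N P \<pi> =
     measure_pmf.expectation (episode_pmf N P \<pi>) (\<lambda>s. real (num_steps s))"

end

theory Submission
  imports Defs "HOL-Combinatorics.Permutations"
begin

text \<open>
  A policy that never fails must perform a depth-first search: going up from a node with an
  unexplored child can never be undone, and a leaf below that child may be the goal. So at every
  history the choice is either forced (up) or among the unexplored children of the current node.
  The law of the environment is invariant under permuting the children at each node label, and
  relabelling the actions in a history accordingly turns the environments consistent with it into
  those consistent with the relabelled history. Any two choices of unexplored children can be
  matched by such a relabelling, so by backward induction the length of the episode, summed over
  the environments consistent with a history, depends neither on the policy nor on the labelling of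
  the actions taken so far.
\<close>

section \<open>Labelled trees\<close>

text \<open>For a single environment the length does depend on the order in which children are
  explored, so an argument environment by environment cannot work; two choices agree only after
  summing over all environments that the agent cannot yet tell apart. These sums carry the prior
  weights unnormalised: a history that no environment allows contributes 0 instead of an undefined
  conditional expectation, and the next observation splits each sum into disjoint parts. Going up is
  irrevocable because re-entry would repeat the \<open>Down\<close> action of the parent, which is
  illegal. Balance is used through invariance: permuting children preserves the uniform law on trees
  of each depth, and it preserves the law of the goal because the child index is uniform. Two
  policies soon follow different histories, so they are compared at histories that agree up to a
  relabelling; its effect on the actions already taken is kept, and it is adjusted only at
  unexplored children.\<close>

lemma self_in_subtrees: "T \<in> subtrees T"
  by (cases T) auto

lemma subtrees_trans: "U \<in> subtrees T \<Longrightarrow> V \<in> subtrees U \<Longrightarrow> V \<in> subtrees T"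
  by (induction T) auto

lemma label_in_labels: "label T \<in> set (labels T)"
  by (cases T) auto

lemma label_subtree_in_labels: "U \<in> subtrees T \<Longrightarrow> label U \<in> set (labels T)"
  by (induction T) auto

lemma labels_eq_subtrees: "set (labels T) = label ` subtrees T"
  by (induction T) auto

lemma full_subtree: "U \<in> subtrees T \<Longrightarrow> full k T \<Longrightarrow> full k U"
  by (induction T) auto

lemma distinct_labels_child: "distinct (labels (Node n ts)) \<Longrightarrow> t \<in> set ts \<Longrightarrow> distinct (labels t)"
  by (auto simp: distinct_concat_iff)

lemma distinct_labels_nth:
  assumes "distinct (labels (Node n ts))" "i < length ts" "j < length ts"
    and "x \<in> set (labels (ts ! i))" "x \<in> set (labels (ts ! j))"
  shows "i = j"
proof (rule ccontr)
  assume "i \<noteq> j"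
  have "distinct (concat (map labels ts))" using assms(1) by simp
  then have "set (labels (ts ! i)) \<inter> set (labels (ts ! j)) = {}"
    using \<open>i \<noteq> j\<close> assms(2,3) by (induction ts arbitrary: i j)
      (fastforce simp: nth_Cons split: nat.splits)+
  then show False using assms(4,5) by blast
qed

text \<open>This justifies treating labels as nodes, and with it the definite descriptions in
  \<open>move\<close>. The root label does not recur below the root, and siblings have disjoint
  label sets, so equal labels lead into the same child.\<close>

lemma subtrees_label_unique:
  assumes "distinct (labels T)" "U \<in> subtrees T" "U' \<in> subtrees T" "label U = label U'"
  shows "U = U'"
  using assms
proof (induction T)
  case (Node n ts)
  have nin: "V \<in> subtrees t \<Longrightarrow> t \<in> set ts \<Longrightarrow> label V \<noteq> n" for V t
    using Node.prems(1) label_subtree_in_labels by fastforce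
  show ?case
  proof (cases "U = Node n ts \<or> U' = Node n ts")
    case True
    then show ?thesis using Node.prems(2-4) nin by (auto; metis ktree.sel(1))
  next
    case False
    then obtain i j where ij: "i < length ts" "U \<in> subtrees (ts ! i)"
      "j < length ts" "U' \<in> subtrees (ts ! j)"
      using Node.prems by (auto simp: in_set_conv_nth)
    then have "i = j"
      using distinct_labels_nth[OF Node.prems(1)] Node.prems(4) label_subtree_in_labels by metis
    then show ?thesis
      using ij Node.IH[of "ts ! i"] Node.prems(1,4) distinct_labels_child by (metis nth_mem)
  qed
qed

section \<open>The parent-child relation on labels\<close>

lemma is_childE:
  assumes "is_child T n i m"
  obtains ts where "Node n ts \<in> subtrees T" "i \<in> {1..length ts}" "m = label (ts ! (i - 1))"
  using assms by (auto simp: is_child_def)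

lemma is_child_functional:
  assumes "distinct (labels T)" "is_child T n i m" "is_child T n i m'"
  shows "m = m'"
  using subtrees_label_unique[OF assms(1)] assms(2,3) unfolding is_child_def
  by (metis ktree.sel(1,2))

lemma is_child_Node:
  "is_child (Node r ts) n i m \<longleftrightarrow>
     (n = r \<and> i \<in> {1..length ts} \<and> m = label (ts ! (i - 1))) \<or> (\<exists>t\<in>set ts. is_child t n i m)"
  by (auto simp: is_child_def)

lemma is_child_in_labels: "is_child T n i m \<Longrightarrow> m \<in> set (labels T)"
proof (erule is_childE)
  fix ts assume ts: "Node n ts \<in> subtrees T" "i \<in> {1..length ts}" "m = label (ts ! (i - 1))"
  then have "ts ! (i - 1) \<in> subtrees (Node n ts)" using self_in_subtrees by force
  then show "m \<in> set (labels T)"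
    using label_subtree_in_labels subtrees_trans ts by blast
qed

lemma is_child_not_root:
  assumes "distinct (labels T)" "is_child T n i m"
  shows "m \<noteq> label T"
proof (cases T)
  case (Node r ts)
  have "m \<in> (\<Union>t\<in>set ts. set (labels t))"
    using assms(2) label_in_labels is_child_in_labels unfolding Node is_child_Node
    by fastforce
  then show ?thesis using assms(1) Node by auto
qed

lemma is_child_unique_parent:
  assumes "distinct (labels T)" "is_child T n i m" "is_child T n' i' m"
  shows "n = n' \<and> i = i'"
  using assms
proof (induction T)
  case (Node r ts)
  have dt: "t \<in> set ts \<Longrightarrow> distinct (labels t)" for t
    using Node.prems(1) distinct_labels_child by blast
  have root: "m \<in> set (labels (ts ! (i - 1)))" if "i \<in> {1..length ts}" "m = label (ts ! (i - 1))" for i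
    using that label_in_labels by simp
  \<comment> \<open>The mixed case: \<open>m\<close> is the root label of one child and a proper
    descendant inside a child. Disjointness of siblings makes these children equal, but a root label
    is never a child within its own tree.\<close>
  have clash: False
    if hyps: "i \<in> {1..length ts}" "m = label (ts ! (i - 1))" "t \<in> set ts" "is_child t n' i' m"
    for i t n' i'
  proof -
    obtain j where j: "j < length ts" "t = ts ! j" using hyps(3) by (auto simp: in_set_conv_nth)
    have "i - 1 = j"
      using distinct_labels_nth[OF Node.prems(1), of "i - 1" j m] root[OF hyps(1,2)]
        is_child_in_labels[OF hyps(4)] j hyps(1) by auto
    then show False using is_child_not_root[OF dt[OF hyps(3)] hyps(4)] hyps(2) j by simp
  qed
  consider
      (rr) "n = r" "i \<in> {1..length ts}" "m = label (ts ! (i - 1))"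
           "n' = r" "i' \<in> {1..length ts}" "m = label (ts ! (i' - 1))"
    | (cc) t t' where "t \<in> set ts" "is_child t n i m" "t' \<in> set ts" "is_child t' n' i' m"
    using Node.prems(2,3) clash unfolding is_child_Node by blast
  then show ?case
  proof cases
    case rr
    have "i - 1 = i' - 1"
      by (rule distinct_labels_nth[OF Node.prems(1), where x = m])
        (use rr root[OF rr(2,3)] root[OF rr(5,6)] in auto)
    then show ?thesis using rr by auto
  next
    case cc
    have "t = t'"
      using distinct_labels_nth[OF Node.prems(1)] is_child_in_labels cc
      by (metis in_set_conv_nth)
    then show ?thesis using Node.IH[of t] cc dt by blast
  qed
qed

definition parent_rel :: "ktree \<Rightarrow> (nat \<times> nat) set" where
  "parent_rel T = {(n, m). \<exists>i. is_child T n i m}"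

lemma size_child: "t \<in> set ts \<Longrightarrow> size t < size (Node n ts)"
  by (induction ts) auto

text \<open>The size of the subtree strictly decreases from parent to child. The measure
  \<open>f\<close> recovers that size from the label, which is possible since a label determines its
  subtree.\<close>

lemma parent_rel_acyclic:
  assumes "distinct (labels T)"
  shows "acyclic (parent_rel T)"
proof -
  define f where "f n = size (THE U. U \<in> subtrees T \<and> label U = n)" for n
  have f: "f (label U) = size U" if "U \<in> subtrees T" for U
    using subtrees_label_unique[OF assms] that unfolding f_def by (metis (mono_tags, lifting) the_equality)
  have "f m < f n" if "is_child T n i m" for n i m
    using that
  proof (rule is_childE)
    fix ts assume ts: "Node n ts \<in> subtrees T" "i \<in> {1..length ts}" "m = label (ts ! (i - 1))"
    then have mem: "ts ! (i - 1) \<in> set ts" by auto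
    then have "ts ! (i - 1) \<in> subtrees T"
      using subtrees_trans[OF ts(1)] self_in_subtrees by auto
    then show ?thesis using f[of "ts ! (i - 1)"] f[OF ts(1)] ts(3) size_child[OF mem] by simp
  qed
  then have "parent_rel T \<subseteq> (inv_image less_than f)\<inverse>" by (auto simp: parent_rel_def)
  then show ?thesis
    by (meson acyclic_converse acyclic_subset wf_acyclic wf_inv_image wf_less_than)
qed

text \<open>Supplies a possible goal inside an unexplored subtree; descending along first children
  finds one.\<close>

lemma leaf_below:
  assumes "U \<in> subtrees T"
  shows "\<exists>g. is_leaf T g \<and> (label U, g) \<in> (parent_rel T)\<^sup>*"
  using assms
proof (induction U)
  case (Node n ts)
  show ?case
  proof (cases ts)
    case Nil
    then show ?thesis using Node.prems by (auto simp: is_leaf_def)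
  next
    case (Cons t us)
    then have "t \<in> subtrees T"
      using subtrees_trans[OF Node.prems] self_in_subtrees by auto
    then obtain g where g: "is_leaf T g" "(label t, g) \<in> (parent_rel T)\<^sup>*"
      using Node.IH[of t] Cons by auto
    have "is_child T n 1 (label t)"
      unfolding is_child_def using Node.prems Cons by (intro exI[of _ ts]) auto
    then have "(n, label t) \<in> parent_rel T" by (auto simp: parent_rel_def)
    then show ?thesis using g by (auto intro: converse_rtrancl_into_rtrancl)
  qed
qed

section \<open>Permuting children\<close>

text \<open>The permutation is indexed by the label, not by the position in the tree, so that one
  family acts on all trees at once, including those the agent cannot yet distinguish. By the
  convention of \<open>permute_list\<close>, position \<open>j\<close> of the new list holds the old
  child \<open>\<tau> n j\<close>.\<close>

primrec reorder :: "(nat \<Rightarrow> nat \<Rightarrow> nat) \<Rightarrow> ktree \<Rightarrow> ktree" where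
  "reorder \<tau> (Node n ts) = Node n (permute_list (\<tau> n) (map (reorder \<tau>) ts))"

definition child_perms :: "nat \<Rightarrow> (nat \<Rightarrow> nat \<Rightarrow> nat) set" where
  "child_perms k = {\<tau>. \<forall>n. \<tau> n permutes {..<k}}"

lemma permute_childrenI:
  assumes "\<tau> \<in> child_perms k" "full k (Node n ts)" "ts \<noteq> []"
  shows "\<tau> n permutes {..<length ts}"
  using assms by (auto simp: child_perms_def)

lemma set_permute_children:
  assumes "\<tau> \<in> child_perms k" "full k (Node n ts)"
  shows "set (permute_list (\<tau> n) (map f ts)) = f ` set ts"
  using permute_childrenI[OF assms] by (cases "ts = []") (simp_all add: set_permute_list)

lemma label_reorder [simp]: "label (reorder \<tau> T) = label T"
  by (cases T) simp

lemma full_reorder: "\<tau> \<in> child_perms k \<Longrightarrow> full k T \<Longrightarrow> full k (reorder \<tau> T)"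
  by (induction T) (auto simp: set_permute_children[where k = k])

lemma depth_reorder: "\<tau> \<in> child_perms k \<Longrightarrow> full k T \<Longrightarrow> depth (reorder \<tau> T) = depth T"
proof (induction T)
  case (Node n ts)
  have "depth ` set (permute_list (\<tau> n) (map (reorder \<tau>) ts)) = depth ` set ts"
    using Node by (subst set_permute_children[where k = k]) (auto simp: image_image)
  moreover have "permute_list (\<tau> n) (map (reorder \<tau>) ts) = [] \<longleftrightarrow> ts = []"
    by (metis length_0_conv length_map length_permute_list)
  ultimately show ?case by simp
qed

lemma mset_labels_reorder:
  "\<tau> \<in> child_perms k \<Longrightarrow> full k T \<Longrightarrow> mset (labels (reorder \<tau> T)) = mset (labels T)"
proof (induction T)
  case (Node n ts)
  show ?case
  proof (cases "ts = []")
    case False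
    let ?us = "map (reorder \<tau>) ts"
    have perm: "\<tau> n permutes {..<length ?us}"
      using permute_childrenI[OF Node.prems False] by simp
    have "mset (map (mset \<circ> labels) (permute_list (\<tau> n) ?us)) = mset (map (mset \<circ> labels) ?us)"
      using mset_permute_list[OF perm] by (metis mset_map)
    then have "sum_list (map (mset \<circ> labels) (permute_list (\<tau> n) ?us))
        = sum_list (map (mset \<circ> labels) ?us)"
      by (metis sum_mset_sum_list)
    also have "map (mset \<circ> labels) ?us = map (mset \<circ> labels) ts"
      using Node by auto
    finally show ?thesis by (simp add: mset_concat o_def)
  qed simp
qed

lemma set_labels_reorder:
  "\<tau> \<in> child_perms k \<Longrightarrow> full k T \<Longrightarrow> set (labels (reorder \<tau> T)) = set (labels T)"
  by (metis mset_labels_reorder set_mset_mset)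

lemma distinct_labels_reorder:
  "\<tau> \<in> child_perms k \<Longrightarrow> full k T \<Longrightarrow> distinct (labels (reorder \<tau> T)) = distinct (labels T)"
  by (metis mset_labels_reorder mset_eq_imp_distinct_iff)

lemma subtrees_reorder:
  "\<tau> \<in> child_perms k \<Longrightarrow> full k T \<Longrightarrow> subtrees (reorder \<tau> T) = reorder \<tau> ` subtrees T"
proof (induction T)
  case (Node n ts)
  have "subtrees (reorder \<tau> t) = reorder \<tau> ` subtrees t" if "t \<in> set ts" for t
    using Node that by auto
  then show ?case
    by (auto simp: set_permute_children[OF Node.prems])
qed

lemma permute_list_eq_Nil [simp]: "permute_list f xs = [] \<longleftrightarrow> xs = []"
  by (metis length_0_conv length_permute_list)

lemma reorder_eq_leaf [simp]: "Node n [] = reorder \<tau> U \<longleftrightarrow> U = Node n []"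
  by (cases U) (auto dest: sym)

section \<open>Observations and moves in a reordered tree\<close>

lemma is_leaf_reorder:
  assumes "\<tau> \<in> child_perms k" "full k T"
  shows "is_leaf (reorder \<tau> T) = is_leaf T"
  by (auto simp: is_leaf_def subtrees_reorder[OF assms] image_iff fun_eq_iff)

lemma observe_reorder:
  assumes "\<tau> \<in> child_perms k" "full k T"
  shows "observe (reorder \<tau> T) = observe T"
  by (auto simp: observe_def is_leaf_reorder[OF assms] fun_eq_iff)

text \<open>Translates from list positions, which start at 0, to child indices, which start at 1.
  The index 0 is fixed, which keeps the map a bijection on all natural numbers.\<close>

definition permute_index :: "(nat \<Rightarrow> nat) \<Rightarrow> nat \<Rightarrow> nat" where
  "permute_index f i = (case i of 0 \<Rightarrow> 0 | Suc j \<Rightarrow> Suc (f j))"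

lemma permute_index_range:
  "f permutes {..<k} \<Longrightarrow> permute_index f i \<in> {1..k} \<longleftrightarrow> i \<in> {1..k}"
  using permutes_in_image[of f "{..<k}"]
  by (cases i) (auto simp: permute_index_def Suc_le_eq)

lemma inj_permute_index: "f permutes A \<Longrightarrow> inj (permute_index f)"
  by (auto simp: permute_index_def inj_def split: nat.splits dest: permutes_inj)

text \<open>\<open>permute_list\<close> reads a new position at its image in the old list, so the
  permutation appears on the side of the original tree and without an inverse.\<close>

lemma is_child_reorder:
  assumes "\<tau> \<in> child_perms k" "full k T"
  shows "is_child (reorder \<tau> T) n i m \<longleftrightarrow> is_child T n (permute_index (\<tau> n) i) m"
proof -
  have child: "label (permute_list (\<tau> n) (map (reorder \<tau>) ts) ! (i - 1))
        = label (ts ! (permute_index (\<tau> n) i - 1))"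
    and range: "i \<in> {1..length ts} \<longleftrightarrow> permute_index (\<tau> n) i \<in> {1..length ts}"
    if ts: "Node n ts \<in> subtrees T" "i \<in> {1..length ts} \<or> permute_index (\<tau> n) i \<in> {1..length ts}" for ts
  proof -
    have "ts \<noteq> []" using ts(2) by auto
    then have perm: "\<tau> n permutes {..<length ts}"
      using permute_childrenI[OF assms(1)] full_subtree[OF ts(1) assms(2)] by blast
    show r: "i \<in> {1..length ts} \<longleftrightarrow> permute_index (\<tau> n) i \<in> {1..length ts}"
      using permute_index_range[OF perm] by auto
    then obtain j where j: "i = Suc j" "j < length ts" using ts(2) by (cases i) auto
    then have "\<tau> n j < length ts" using permutes_in_image[OF perm] by auto
    then show "label (permute_list (\<tau> n) (map (reorder \<tau>) ts) ! (i - 1))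
        = label (ts ! (permute_index (\<tau> n) i - 1))"
      using perm j by (simp add: permute_list_nth permute_index_def)
  qed
  have sub: "Node n us \<in> subtrees (reorder \<tau> T) \<longleftrightarrow>
      (\<exists>ts. Node n ts \<in> subtrees T \<and> us = permute_list (\<tau> n) (map (reorder \<tau>) ts))" for us
    unfolding subtrees_reorder[OF assms] image_iff
    by (metis ktree.inject ktree.exhaust reorder.simps)
  show ?thesis
  proof
    assume "is_child (reorder \<tau> T) n i m"
    then obtain ts where ts: "Node n ts \<in> subtrees T" "i \<in> {1..length ts}"
      "m = label (permute_list (\<tau> n) (map (reorder \<tau>) ts) ! (i - 1))"
      by (auto simp: is_child_def sub)
    then show "is_child T n (permute_index (\<tau> n) i) m"
      using child[OF ts(1)] range[OF ts(1)] by (auto simp: is_child_def)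
  next
    assume "is_child T n (permute_index (\<tau> n) i) m"
    then obtain ts where ts: "Node n ts \<in> subtrees T" "permute_index (\<tau> n) i \<in> {1..length ts}"
      "m = label (ts ! (permute_index (\<tau> n) i - 1))"
      by (rule is_childE)
    then have "i \<in> {1..length ts}"
      "m = label (permute_list (\<tau> n) (map (reorder \<tau>) ts) ! (i - 1))"
      using child[OF ts(1)] range[OF ts(1)] by auto
    then show "is_child (reorder \<tau> T) n i m"
      unfolding is_child_def sub using ts(1) by fastforce
  qed
qed

lemma ex_permute_index:
  assumes "f permutes {..<k}"
  shows "(\<exists>i. P (permute_index f i)) \<longleftrightarrow> (\<exists>i. P i)"
proof -
  have "\<exists>j. permute_index f j = i" for i
    using permutes_surj[OF assms] by (cases i)
     (auto simp: permute_index_def intro: exI[of _ 0], metis nat.simps(5) surjD)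
  then show ?thesis by metis
qed

primrec permute_action :: "(nat \<Rightarrow> nat) \<Rightarrow> action \<Rightarrow> action" where
  "permute_action f Up = Up"
| "permute_action f (Down i) = Down (permute_index f i)"

lemma inj_permute_action: "f permutes A \<Longrightarrow> inj (permute_action f)"
  unfolding inj_def using inj_permute_index[THEN injD]
  by (metis action.exhaust action.inject action.simps(3) permute_action.simps)

text \<open>For \<open>Down\<close> the index is translated. For \<open>Up\<close> the child index
  is existentially quantified, and a bijection of the indices does not change that.\<close>

lemma move_reorder:
  assumes "\<tau> \<in> child_perms k" "full k T"
  shows "move (reorder \<tau> T) n a = move T n (permute_action (\<tau> n) a)"
proof -
  have "(\<exists>i. is_child T m (permute_index (\<tau> m) i) n) \<longleftrightarrow> (\<exists>i. is_child T m i n)" for m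
    using assms(1) by (intro ex_permute_index) (auto simp: child_perms_def)
  then show ?thesis
    by (cases a) (simp_all add: is_child_reorder[OF assms, THEN ext])
qed

text \<open>A position of the final list is looked up first through the later permutation
  \<open>\<tau>'\<close> and then through \<open>\<tau>\<close>, whence the order of composition.
  The lemma serves to invert \<open>reorder\<close>.\<close>

lemma reorder_reorder:
  assumes "\<tau> \<in> child_perms k" "\<tau>' \<in> child_perms k"
  shows "full k T \<Longrightarrow> reorder \<tau>' (reorder \<tau> T) = reorder (\<lambda>n. \<tau> n \<circ> \<tau>' n) T"
proof (induction T)
  case (Node n ts)
  show ?case
  proof (cases "ts = []")
    case False
    then have perm: "\<tau> n permutes {..<length ts}" "\<tau>' n permutes {..<length ts}"
      using permute_childrenI[OF _ Node.prems] assms by auto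
    have *: "map (reorder \<tau>') (permute_list (\<tau> n) (map (reorder \<tau>) ts))
        = permute_list (\<tau> n) (map (reorder (\<lambda>n. \<tau> n \<circ> \<tau>' n)) ts)"
      using Node perm by (subst permute_list_map[symmetric])
        (auto simp: o_def intro!: arg_cong[where f = "permute_list (\<tau> n)"])
    have "permute_list (\<tau> n \<circ> \<tau>' n) us = permute_list (\<tau>' n) (permute_list (\<tau> n) us)"
      if "length us = length ts" for us :: "ktree list"
      using perm that by (intro permute_list_compose) auto
    then show ?thesis
      by (simp only: reorder.simps * length_map)
  qed simp
qed

lemma reorder_id: "reorder (\<lambda>n. id) T = T"
  by (induction T) (simp add: map_idI)

lemma child_perms_inv: "\<tau> \<in> child_perms k \<Longrightarrow> (\<lambda>n. inv (\<tau> n)) \<in> child_perms k"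
  by (auto simp: child_perms_def permutes_inv)

lemma reorder_inverse:
  assumes "\<tau> \<in> child_perms k" "full k T"
  shows "reorder (\<lambda>n. inv (\<tau> n)) (reorder \<tau> T) = T"
proof -
  have "\<tau> n \<circ> inv (\<tau> n) = id" for n
    using assms(1) permutes_inv_o(1) by (auto simp: child_perms_def)
  then show ?thesis
    using reorder_reorder[OF assms(1) child_perms_inv[OF assms(1)] assms(2)] reorder_id by simp
qed

section \<open>Legal histories\<close>

definition actions :: "nat \<Rightarrow> action set" where
  "actions k = insert Up (Down ` {1..k})"

lemma policy_actions: "\<pi> \<in> policies k \<Longrightarrow> set_pmf (\<pi> s) \<subseteq> actions k"
  unfolding policies_def actions_def by blast

lemma finite_policy_support: "\<pi> \<in> policies k \<Longrightarrow> finite (set_pmf (\<pi> s))"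
  by (rule finite_subset[OF policy_actions]) (auto simp: actions_def)

text \<open>No policy enters, only the allowed actions, so the environments compatible with a
  history are the same for every policy.\<close>

inductive valid :: "nat \<Rightarrow> ktree \<Rightarrow> nat \<Rightarrow> history \<Rightarrow> bool" for k T g where
  init: "valid k T g (init_history T g)"
| step: "valid k T g s \<Longrightarrow> \<not> at_goal s \<Longrightarrow> a \<in> actions k \<Longrightarrow> \<not> illegal T s a \<Longrightarrow>
    valid k T g (next_history T g s a)"

lemma valid_Nil: "valid k T g ([], ob) \<longleftrightarrow> ob = observe T g (label T)"
  by (subst valid.simps) (auto simp: init_history_def next_history_def)

lemma valid_snoc:
  "valid k T g (xs @ [(ob, a)], ob') \<longleftrightarrow>
     valid k T g (xs, ob) \<and> snd ob \<noteq> Goal \<and> a \<in> actions k \<and> \<not> illegal T (xs, ob) a \<and>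
     ob' = observe T g (move T (fst ob) a)"
  by (subst valid.simps)
    (auto simp: init_history_def next_history_def at_goal_def current_node_def)

lemma fst_observe [simp]: "fst (observe T g n) = n"
  by (simp add: observe_def)

lemma valid_observe: "valid k T g s \<Longrightarrow> snd s = observe T g (current_node s)"
  by (induction rule: valid.induct)
    (auto simp: init_history_def next_history_def current_node_def)

lemma valid_at_goal: "valid k T g s \<Longrightarrow> at_goal s \<Longrightarrow> current_node s = g"
  by (drule valid_observe) (auto simp: at_goal_def observe_def split: if_splits)

section \<open>Explored actions and entered nodes\<close>

definition used :: "history \<Rightarrow> nat \<Rightarrow> action \<Rightarrow> bool" where
  "used s n a \<longleftrightarrow> (\<exists>c. ((n, c), a) \<in> set (fst s))"

lemma taken_used: "taken s a \<longleftrightarrow> used s (current_node s) a"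
  by (simp add: taken_def used_def)

lemma used_init [simp]: "\<not> used (init_history T g) n a"
  by (simp add: used_def init_history_def)

lemma used_next:
  "used (next_history T g s a) n b \<longleftrightarrow> used s n b \<or> n = current_node s \<and> b = a"
  by (cases "snd s") (auto simp: used_def next_history_def current_node_def)

lemma current_next [simp]:
  "current_node (next_history T g s a) = move T (current_node s) a"
  by (simp add: current_node_def next_history_def)

text \<open>Recorded through the action at the parent, because this is the action whose repetition
  is forbidden.\<close>

definition entered :: "ktree \<Rightarrow> history \<Rightarrow> nat \<Rightarrow> bool" where
  "entered T s m \<longleftrightarrow> (\<exists>n i. is_child T n i m \<and> used s n (Down i))"

lemma entered_child:
  assumes "distinct (labels T)" "is_child T n i m"
  shows "entered T s m \<longleftrightarrow> used s n (Down i)"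
  using assms is_child_unique_parent unfolding entered_def by blast

lemma entered_next:
  "entered T (next_history T g s a) m \<longleftrightarrow>
     entered T s m \<or> (\<exists>i. a = Down i \<and> is_child T (current_node s) i m)"
  by (auto simp: entered_def used_next)

lemma move_Down:
  assumes "distinct (labels T)" "is_child T n i m"
  shows "move T n (Down i) = m"
  using assms is_child_functional by (auto intro!: the_equality)

lemma move_Up:
  assumes "distinct (labels T)" "is_child T n i m"
  shows "move T m Up = n"
  using assms is_child_unique_parent by (auto intro!: the_equality)

lemma is_child_parent_in_labels: "is_child T n i m \<Longrightarrow> n \<in> set (labels T)"
  by (metis is_child_def label_subtree_in_labels ktree.sel(1))

lemma inner_has_child:
  assumes "full k T" "n \<in> set (labels T)" "\<not> is_leaf T n" "i \<in> {1..k}"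
  obtains m where "is_child T n i m"
proof -
  obtain ts where ts: "Node n ts \<in> subtrees T"
    using assms(2) by (metis imageE ktree.exhaust_sel labels_eq_subtrees)
  then have "length ts = k"
    using assms(3) full_subtree[OF ts assms(1)] by (auto simp: is_leaf_def)
  then show ?thesis using that ts assms(4) by (auto simp: is_child_def)
qed

lemma root_no_ancestor:
  assumes "distinct (labels T)" "(m, label T) \<in> (parent_rel T)\<^sup>*"
  shows "m = label T"
  using assms(2) is_child_not_root[OF assms(1)]
  by (cases rule: rtranclE) (auto simp: parent_rel_def)

text \<open>The nodes entered and not yet left upwards are exactly the non-root nodes on the path from
  the root to the current node; only one inclusion is needed.\<close>

lemma valid_path_invariant:
  assumes T: "distinct (labels T)" "full k T" and "valid k T g s"
  shows "current_node s \<in> set (labels T) \<and> (\<forall>m. used s m Up \<longrightarrow> entered T s m) \<and>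
    (\<forall>m. (m, current_node s) \<in> (parent_rel T)\<^sup>* \<longrightarrow> m \<noteq> label T \<longrightarrow>
      entered T s m \<and> \<not> used s m Up)"
  using assms(3)
proof induction
  case init
  have "current_node (init_history T g) = label T"
    by (simp add: current_node_def init_history_def)
  then show ?case
    using root_no_ancestor[OF T(1)] by (auto simp: label_in_labels)
next
  case (step s a)
  let ?c = "current_node s"
  let ?s = "next_history T g s a"
  show ?case
  proof (cases a)
    case Up
    then have c: "?c \<noteq> label T" using step.hyps by (auto simp: illegal_def)
    then have ec: "entered T s ?c" using step.IH by blast
    then obtain q i where q: "is_child T q i ?c" by (auto simp: entered_def)
    have mv: "move T ?c a = q" unfolding Up by (rule move_Up[OF T(1) q])
    have qc: "(q, ?c) \<in> parent_rel T" using q by (auto simp: parent_rel_def)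
    have "entered T ?s m \<and> \<not> used ?s m Up"
      if m: "(m, q) \<in> (parent_rel T)\<^sup>*" "m \<noteq> label T" for m
    proof -
      \<comment> \<open>After moving up, the remaining path consists of proper ancestors of
        \<open>?c\<close>; by acyclicity the new \<open>Up\<close> at \<open>?c\<close> touches none
        of them.\<close>
      have mc: "(m, ?c) \<in> (parent_rel T)\<^sup>+" using m(1) qc by auto
      then have "m \<noteq> ?c" using parent_rel_acyclic[OF T(1)] by (auto simp: acyclic_def)
      then show ?thesis
        using step.IH m mc by (auto simp: used_next entered_next dest: trancl_into_rtrancl)
    qed
    then show ?thesis
      using mv step.IH ec is_child_parent_in_labels[OF q]
      by (auto simp: used_next entered_next)
  next
    case (Down i)
    then have i: "i \<in> {1..k}" and nl: "\<not> is_leaf T ?c" and nt: "\<not> used s ?c (Down i)"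
      using step.hyps by (auto simp: actions_def illegal_def taken_used)
    obtain m' where m': "is_child T ?c i m'"
      using inner_has_child[OF T(2) _ nl i] step.IH by blast
    have mv: "move T ?c a = m'" unfolding Down by (rule move_Down[OF T(1) m'])
    \<comment> \<open>By the invariant an earlier \<open>Up\<close> at \<open>m'\<close> would mean
      that \<open>m'\<close> had been entered, that is, \<open>Down i\<close> already taken at
      \<open>?c\<close>; legality excludes this.\<close>
    have new: "\<not> used s m' Up"
      using step.IH nt entered_child[OF T(1) m'] by blast
    have "entered T ?s m \<and> \<not> used ?s m Up"
      if m: "(m, m') \<in> (parent_rel T)\<^sup>*" "m \<noteq> label T" for m
      using m(1)
    proof (cases rule: rtranclE)
      case base
      then show ?thesis using new m' Down by (auto simp: used_next entered_next)
    next
      case (step q)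
      then have "q = ?c"
        using is_child_unique_parent[OF T(1) m'] by (auto simp: parent_rel_def)
      then show ?thesis
        using \<open>(m, q) \<in> _\<close> m(2) step.IH Down by (auto simp: used_next entered_next)
    qed
    then show ?thesis
      using mv step.IH is_child_in_labels[OF m'] Down
      by (auto simp: used_next entered_next)
  qed
qed

text \<open>By the path invariant, standing at \<open>g\<close> requires that its ancestor
  \<open>m\<close> has been entered through \<open>Down i\<close> at \<open>n\<close>. But a
  non-root node at which \<open>Up\<close> has been used is never the current node again, so
  \<open>Down i\<close> cannot be taken there any more.\<close>

lemma rollout_never_reaches_lost_subtree:
  assumes T: "distinct (labels T)" "full k T" and pol: "\<pi> \<in> policies k"
    and nim: "is_child T n i m" "n \<noteq> label T" and g: "(m, g) \<in> (parent_rel T)\<^sup>*"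
  shows "valid k T g s \<Longrightarrow> used s n Up \<Longrightarrow> \<not> used s n (Down i) \<Longrightarrow>
    x \<in> set_pmf (rollout \<pi> T g h s) \<Longrightarrow> \<not> at_goal x"
proof (induction h arbitrary: s)
  case (0 s)
  have "m \<noteq> label T" using is_child_not_root[OF T(1) nim(1)] .
  then have "current_node s \<noteq> g"
    using valid_path_invariant[OF T "0.prems"(1)] g entered_child[OF T(1) nim(1)] "0.prems"(3)
    by blast
  then have "\<not> at_goal s" using valid_at_goal[OF "0.prems"(1)] by blast
  then show ?case using "0.prems" by simp
next
  case (Suc h)
  have "m \<noteq> label T" using is_child_not_root[OF T(1) nim(1)] .
  then have "current_node s \<noteq> g"
    using valid_path_invariant[OF T Suc.prems(1)] g entered_child[OF T(1) nim(1)] Suc.prems(3)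
    by blast
  then have ng: "\<not> at_goal s" using valid_at_goal[OF Suc.prems(1)] by blast
  have nn: "current_node s \<noteq> n"
    using valid_path_invariant[OF T Suc.prems(1)] nim(2) Suc.prems(2) by blast
  obtain a where a: "a \<in> set_pmf (\<pi> s)"
    "x \<in> set_pmf (if illegal T s a then return_pmf s else rollout \<pi> T g h (next_history T g s a))"
    using Suc.prems(4) ng by auto
  show ?case
  proof (cases "illegal T s a")
    case True
    then show ?thesis using a ng by auto
  next
    case False
    have "a \<in> actions k" using a(1) policy_actions[OF pol] by blast
    then have v: "valid k T g (next_history T g s a)"
      using Suc.prems(1) ng False by (intro valid.step)
    show ?thesis
      by (rule Suc.IH[OF v]) (use Suc.prems nn a False in \<open>auto simp: used_next\<close>)
  qed
qed

text \<open>The goal affects an observation only at the goal itself, so a history that has visited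
  neither goal cannot tell them apart. Prefixes are given by \<open>take\<close> and include
  \<open>s\<close> itself.\<close>

lemma valid_change_goal:
  assumes "valid k T g s" "\<not> at_goal s"
    and "\<And>s'. valid k T g s' \<Longrightarrow> fst s' = take (length (fst s')) (fst s) \<Longrightarrow> current_node s' \<noteq> g'"
  shows "valid k T g' s"
  using assms
proof (induction rule: valid.induct)
  case init
  have "label T \<noteq> g'"
    using init(2)[OF valid.init] by (simp add: init_history_def current_node_def)
  then have "init_history T g = init_history T g'"
    using init(1) by (auto simp: init_history_def observe_def at_goal_def split: if_splits)
  then show ?case by (metis valid.init)
next
  case (step s a)
  let ?s = "next_history T g s a"
  have "valid k T g ?s" using step.hyps by (intro valid.step)
  then have "move T (current_node s) a \<noteq> g'"
    using step.prems(2)[of ?s] by simp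
  then have eq: "?s = next_history T g' s a"
    using step.prems(1) by (auto simp: next_history_def observe_def at_goal_def split: if_splits)
  have "valid k T g' s"
  proof (rule step.IH[OF step.hyps(2)])
    fix s' assume s': "valid k T g s'" "fst s' = take (length (fst s')) (fst s)"
    then have "length (fst s') \<le> length (fst s)" by (metis nat_le_linear take_all)
    then have "fst s' = take (length (fst s')) (fst ?s)"
      using s'(2) by (simp add: next_history_def)
    then show "current_node s' \<noteq> g'" using step.prems(2) s'(1) by blast
  qed
  then have "valid k T g' (next_history T g' s a)"
    using step.hyps by (intro valid.step)
  then show ?case using eq by simp
qed

lemma used_prefix: "fst s' = take l (fst s) \<Longrightarrow> used s' n a \<Longrightarrow> used s n a"
  by (auto simp: used_def dest: in_set_takeD)

text \<open>An adversary argument: move the goal to a leaf below the unexplored child. The history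
  stays possible, \<open>Up\<close> still has positive probability, and afterwards this goal is out
  of reach. Therefore \<open>succ\<close> has to range over all goals compatible with the
  history.\<close>

lemma successful_explores_before_Up:
  assumes T: "distinct (labels T)" "full k T" and pol: "\<pi> \<in> policies k"
    and v: "valid k T g s" and ng: "\<not> at_goal s" and nl: "\<not> is_leaf T (current_node s)"
    and up: "Up \<in> set_pmf (\<pi> s)" and i: "i \<in> {1..k}"
    and succ: "\<And>g' x. is_leaf T g' \<Longrightarrow> valid k T g' s \<Longrightarrow>
        x \<in> set_pmf (rollout \<pi> T g' (Suc h) s) \<Longrightarrow> at_goal x"
  shows "taken s (Down i)"
proof (rule ccontr)
  assume "\<not> taken s (Down i)"
  let ?c = "current_node s"
  have nu: "\<not> used s ?c (Down i)" using \<open>\<not> taken s (Down i)\<close> by (simp add: taken_used)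
  have cT: "?c \<in> set (labels T)" using valid_path_invariant[OF T v] by blast
  obtain m where m: "is_child T ?c i m" using inner_has_child[OF T(2) cT nl i] .
  obtain U where "U \<in> subtrees T" "label U = m"
    using is_child_in_labels[OF m] by (auto simp: labels_eq_subtrees)
  then obtain g' where g': "is_leaf T g'" "(m, g') \<in> (parent_rel T)\<^sup>*"
    using leaf_below by blast
  have mr: "m \<noteq> label T" using is_child_not_root[OF T(1) m] .
  have v': "valid k T g' s"
  proof (rule valid_change_goal[OF v ng])
    fix s' assume s': "valid k T g s'" "fst s' = take (length (fst s')) (fst s)"
    show "current_node s' \<noteq> g'"
      using valid_path_invariant[OF T s'(1)] g'(2) mr entered_child[OF T(1) m]
        used_prefix[OF s'(2)] nu by blast
  qed
  \<comment> \<open>An illegal \<open>Up\<close> would end the episode at \<open>s\<close>, away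
    from the goal, which already contradicts sure success.\<close>
  have leg: "\<not> illegal T s Up"
  proof
    assume "illegal T s Up"
    then have "s \<in> set_pmf (rollout \<pi> T g' (Suc h) s)" using up ng by auto
    then show False using succ[OF g'(1) v'] ng by blast
  qed
  let ?s = "next_history T g' s Up"
  have vs: "valid k T g' ?s"
    using v' ng leg by (intro valid.step) (auto simp: actions_def)
  obtain x where x: "x \<in> set_pmf (rollout \<pi> T g' h ?s)"
    using set_pmf_not_empty by fastforce
  have "\<not> at_goal x"
  proof (rule rollout_never_reaches_lost_subtree[OF T pol m _ g'(2) vs _ _ x])
    show "?c \<noteq> label T" using leg by (auto simp: illegal_def)
  qed (use nu in \<open>auto simp: used_next\<close>)
  moreover have "x \<in> set_pmf (rollout \<pi> T g' (Suc h) s)"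
    using up ng leg x by auto
  ultimately show False using succ[OF g'(1) v'] by blast
qed

section \<open>Backward induction over histories\<close>

text \<open>Observations stay as they are because reordering changes neither labels nor leaves; only
  the meaning of \<open>Down\<close> at each node changes.\<close>

definition permute_history :: "(nat \<Rightarrow> nat \<Rightarrow> nat) \<Rightarrow> history \<Rightarrow> history" where
  "permute_history \<tau> s = (map (\<lambda>(ob, a). (ob, permute_action (\<tau> (fst ob)) a)) (fst s), snd s)"

lemma snd_permute_history [simp]: "snd (permute_history \<tau> s) = snd s"
  by (simp add: permute_history_def)

lemma permute_history_simps [simp]:
  "current_node (permute_history \<tau> s) = current_node s"
  "at_goal (permute_history \<tau> s) = at_goal s"
  "num_steps (permute_history \<tau> s) = num_steps s"
  by (simp_all add: permute_history_def current_node_def at_goal_def num_steps_def)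

lemma permute_history_snoc:
  "permute_history \<tau> (xs @ [(ob, a)], ob') =
     (fst (permute_history \<tau> (xs, ob)) @ [(ob, permute_action (\<tau> (fst ob)) a)], ob')"
  by (simp add: permute_history_def)

lemma child_permsD: "\<tau> \<in> child_perms k \<Longrightarrow> \<tau> n permutes {..<k}"
  by (simp add: child_perms_def)

lemma used_permute_history:
  assumes "\<tau> \<in> child_perms k"
  shows "used (permute_history \<tau> s) n (permute_action (\<tau> n) a) \<longleftrightarrow> used s n a"
  using inj_permute_action[OF child_permsD[OF assms], of n]
  by (force simp: used_def permute_history_def image_iff dest: injD)

lemma permute_action_in_actions:
  "f permutes {..<k} \<Longrightarrow> permute_action f a \<in> actions k \<longleftrightarrow> a \<in> actions k"
  using permute_index_range[of f k] by (cases a) (auto simp: actions_def)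

lemma illegal_reorder:
  assumes "\<tau> \<in> child_perms k" "full k T"
  shows "illegal (reorder \<tau> T) s a \<longleftrightarrow>
    illegal T (permute_history \<tau> s) (permute_action (\<tau> (current_node s)) a)"
  using used_permute_history[OF assms(1), of s "current_node s" a]
  by (cases a) (simp_all add: illegal_def taken_used is_leaf_reorder[OF assms])

text \<open>Reordering the tree and relabelling the actions are two descriptions of the same walk:
  observations, moves and legality all correspond, so the last step of the history can be peeled
  off.\<close>

lemma valid_reorder:
  assumes "\<tau> \<in> child_perms k" "full k T"
  shows "valid k (reorder \<tau> T) g s \<longleftrightarrow> valid k T g (permute_history \<tau> s)"
proof -
  have "valid k (reorder \<tau> T) g (xs, ob) \<longleftrightarrow> valid k T g (permute_history \<tau> (xs, ob))" for xs ob
  proof (induction xs arbitrary: ob rule: rev_induct)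
    case Nil
    then show ?case
      by (simp add: permute_history_def valid_Nil observe_reorder[OF assms])
  next
    case (snoc x xs)
    obtain ob0 a where x: "x = (ob0, a)" by (cases x)
    have "permute_history \<tau> (xs, ob0) = (fst (permute_history \<tau> (xs, ob0)), ob0)"
      by (simp add: permute_history_def)
    then show ?case
      using snoc.IH[of ob0]
      by (simp add: x permute_history_snoc valid_snoc observe_reorder[OF assms]
          move_reorder[OF assms] illegal_reorder[OF assms] current_node_def
          permute_action_in_actions[OF child_permsD[OF assms(1)]])
  qed
  then show ?thesis by (metis surj_pair)
qed

text \<open>At the current node \<open>\<tau>\<close> is followed by the transposition of
  \<open>\<tau> ?n j'\<close> and \<open>j\<close>, which sends \<open>j'\<close> to
  \<open>j\<close>. Both values belong to unexplored children, so the image of the recorded history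
  is unchanged.\<close>

lemma child_perms_extend:
  assumes \<tau>: "\<tau> \<in> child_perms k" and a: "a \<in> actions k" "a' \<in> actions k" "a = Up \<longleftrightarrow> a' = Up"
    and nt: "\<not> taken (permute_history \<tau> s') a" "\<not> taken s' a'"
  obtains \<tau>' where "\<tau>' \<in> child_perms k" "permute_history \<tau>' s' = permute_history \<tau> s'"
    "permute_action (\<tau>' (current_node s')) a' = a"
proof (cases a)
  case Up
  then show ?thesis using that[OF \<tau>] a(3) by simp
next
  case (Down i)
  then obtain i' where i': "a' = Down i'" using a(3) by (cases a') auto
  obtain j j' where j: "i = Suc j" "i' = Suc j'" "j < k" "j' < k"
    using a(1,2) Down i' by (auto simp: actions_def image_iff Suc_le_eq gr0_conv_Suc)
  let ?n = "current_node s'"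
  let ?t = "Transposition.transpose (\<tau> ?n j') j"
  define \<tau>' where "\<tau>' = \<tau>(?n := ?t \<circ> \<tau> ?n)"
  have p: "\<tau> ?n permutes {..<k}" using child_permsD[OF \<tau>] .
  have "\<tau> ?n j' \<in> {..<k}" using permutes_in_image[OF p] j by auto
  then have "?t permutes {..<k}" using j by (intro permutes_swap_id) auto
  then have "?t \<circ> \<tau> ?n permutes {..<k}" using permutes_compose[OF p] by blast
  then have mem: "\<tau>' \<in> child_perms k"
    using \<tau> by (simp add: \<tau>'_def child_perms_def)
  have same: "permute_action (\<tau>' (fst ob)) b = permute_action (\<tau> (fst ob)) b"
    if ob: "(ob, b) \<in> set (fst s')" for ob b
  \<comment> \<open>At other nodes \<open>\<tau>'\<close> equals \<open>\<tau>\<close>, while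
    \<open>Up\<close> and \<open>Down 0\<close> are fixed by every relabelling. Only genuine child
    indices used at \<open>?n\<close> remain, and neither \<open>a\<close> nor \<open>a'\<close>
    comes from one of these.\<close>
  proof (cases "fst ob = ?n \<and> b \<noteq> Up \<and> b \<noteq> Down 0")
    case True
    then obtain u where u: "b = Down (Suc u)"
      by (cases b) (auto simp: gr0_conv_Suc)
    have "used s' ?n b" using ob True by (cases ob) (auto simp: used_def)
    then have "b \<noteq> a'" "permute_action (\<tau> ?n) b \<noteq> a"
      using nt used_permute_history[OF \<tau>, of s' ?n b] by (auto simp: taken_used)
    then have "u \<noteq> j'" "\<tau> ?n u \<noteq> j"
      using u Down i' j by (auto simp: permute_index_def)
    moreover from this have "\<tau> ?n u \<noteq> \<tau> ?n j'"
      using permutes_inj[OF p] by (auto dest: injD)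
    ultimately show ?thesis using u True by (simp add: \<tau>'_def permute_index_def)
  next
    case False
    then show ?thesis
      by (cases b) (auto simp: \<tau>'_def permute_index_def)
  qed
  have "permute_history \<tau>' s' = permute_history \<tau> s'"
    using same by (auto simp: permute_history_def)
  moreover have "permute_action (\<tau>' ?n) a' = a"
    using i' Down j by (simp add: \<tau>'_def permute_index_def)
  ultimately show ?thesis using that mem by blast
qed

section \<open>Episode lengths summed over consistent environments\<close>

lemma finite_rollout:
  assumes "\<pi> \<in> policies k"
  shows "finite (set_pmf (rollout \<pi> T g h s))"
proof (induction h arbitrary: s)
  case (Suc h)
  then show ?case using finite_policy_support[OF assms] by auto
qed simp

text \<open>Isolates what the induction uses of the environment law: \<open>change_goal\<close>
  feeds the adversary argument, \<open>reorder_envs\<close> matches different choices of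
  children.\<close>

locale symmetric_envs =
  fixes k :: nat and P :: "(ktree \<times> nat) pmf"
  assumes finite_envs: "finite (set_pmf P)"
    and full_env: "(T, g) \<in> set_pmf P \<Longrightarrow> full k T"
    and distinct_env: "(T, g) \<in> set_pmf P \<Longrightarrow> distinct (labels T)"
    and change_goal: "(T, g) \<in> set_pmf P \<Longrightarrow> is_leaf T g' \<Longrightarrow> (T, g') \<in> set_pmf P"
    and reorder_envs: "\<tau> \<in> child_perms k \<Longrightarrow> map_pmf (\<lambda>(T, g). (reorder \<tau> T, g)) P = P"
begin

definition consistent :: "history \<Rightarrow> (ktree \<times> nat) set" where
  "consistent s = {(T, g). (T, g) \<in> set_pmf P \<and> valid k T g s}"

text \<open>The prior weight of the environments, without the probabilities of the choices made by
  the policy.\<close>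

definition mass :: "history \<Rightarrow> real" where
  "mass s = (\<Sum>e\<in>consistent s. pmf P e)"

text \<open>Lengths are counted from the start of the episode, not from \<open>s\<close>.\<close>

definition exp_length :: "policy \<Rightarrow> nat \<Rightarrow> history \<Rightarrow> ktree \<times> nat \<Rightarrow> real" where
  "exp_length \<pi> h s = (\<lambda>(T, g). measure_pmf.expectation (rollout \<pi> T g h s) (\<lambda>x. real (num_steps x)))"

text \<open>Divided by a nonzero \<open>mass s\<close>, this is the expected length under the prior
  conditioned on \<open>consistent s\<close>.\<close>

definition total_length :: "policy \<Rightarrow> nat \<Rightarrow> history \<Rightarrow> real" where
  "total_length \<pi> h s = (\<Sum>e\<in>consistent s. pmf P e * exp_length \<pi> h s e)"

definition surely_succeeds :: "policy \<Rightarrow> nat \<Rightarrow> history \<Rightarrow> bool" where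
  "surely_succeeds \<pi> h s \<longleftrightarrow>
     (\<forall>(T, g)\<in>consistent s. \<forall>x\<in>set_pmf (rollout \<pi> T g h s). at_goal x)"

lemma finite_consistent: "finite (consistent s)"
  by (rule finite_subset[OF _ finite_envs]) (auto simp: consistent_def)

lemma mass_eq_prob: "mass s = measure_pmf.prob P {(T, g). valid k T g s}"
proof -
  have "measure_pmf.prob P {(T, g). valid k T g s} = measure_pmf.prob P (consistent s)"
    unfolding measure_Int_set_pmf[of P "{(T, g). valid k T g s}", symmetric]
    by (rule arg_cong[where f = "measure_pmf.prob P"]) (auto simp: consistent_def)
  then show ?thesis by (simp add: mass_def measure_measure_pmf_finite finite_consistent)
qed

lemma mass_permute_history:
  assumes "\<tau> \<in> child_perms k"
  shows "mass (permute_history \<tau> s) = mass s"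
proof -
  let ?f = "\<lambda>(T, g). (reorder \<tau> T, g :: nat)"
  have "mass s = measure_pmf.prob (map_pmf ?f P) {(T, g). valid k T g s}"
    by (simp add: mass_eq_prob reorder_envs[OF assms])
  also have "\<dots> = measure_pmf.prob P (?f -` {(T, g). valid k T g s})"
    by simp
  also have "\<dots> = mass (permute_history \<tau> s)"
    unfolding mass_eq_prob
    \<comment> \<open>The correspondence of valid histories is available for full trees, that is, on
      the support of \<open>P\<close>; elsewhere the point masses vanish.\<close>
    by (rule measure_prob_cong_0)
      (auto simp: set_pmf_iff[symmetric] valid_reorder[OF assms full_env] pmf_eq_0_set_pmf)
  finally show ?thesis by simp
qed

lemma mass_eq_0: "mass s = 0 \<longleftrightarrow> consistent s = {}"
  unfolding mass_def
  by (subst sum_nonneg_eq_0_iff[OF finite_consistent]) (auto simp: pmf_eq_0_set_pmf consistent_def)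

lemma total_length_stopped:
  assumes "h = 0 \<or> at_goal s"
  shows "total_length \<pi> h s = real (num_steps s) * mass s"
proof -
  have "exp_length \<pi> h s e = real (num_steps s)" for e
    using assms by (cases h; cases e) (auto simp: exp_length_def)
  then show ?thesis by (simp add: total_length_def mass_def sum_distrib_left mult.commute)
qed

text \<open>Unlike in \<open>next_history\<close>, the observation is a free argument, so
  environments can be grouped by what they reveal.\<close>

definition extend :: "history \<Rightarrow> action \<Rightarrow> obs \<Rightarrow> history" where
  "extend s a ob = (fst s @ [(snd s, a)], ob)"

context
  fixes \<pi> h s
  assumes pol: "\<pi> \<in> policies k" and succ: "surely_succeeds \<pi> (Suc h) s"
    and ng: "\<not> at_goal s"
begin

lemma legal_choice:
  assumes "(T, g) \<in> consistent s" "a \<in> set_pmf (\<pi> s)"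
  shows "\<not> illegal T s a"
proof
  assume "illegal T s a"
  then have "s \<in> set_pmf (rollout \<pi> T g (Suc h) s)" using assms ng by auto
  then show False using succ assms(1) ng by (auto simp: surely_succeeds_def)
qed

lemma choice_in_actions: "a \<in> set_pmf (\<pi> s) \<Longrightarrow> a \<in> actions k"
  using policy_actions[OF pol] by blast

text \<open>A surely successful policy chooses only actions that are legal in every consistent
  environment, so its action excludes none; only the next observation filters.\<close>

lemma consistent_extend:
  assumes "a \<in> set_pmf (\<pi> s)"
  shows "consistent (extend s a ob) =
    {e \<in> consistent s. (case e of (T, g) \<Rightarrow> observe T g (move T (current_node s) a)) = ob}"
  using legal_choice[OF _ assms] choice_in_actions[OF assms] ng
  by (cases s) (auto simp: consistent_def extend_def valid_snoc at_goal_def current_node_def)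

lemma surely_succeeds_extend:
  assumes "a \<in> set_pmf (\<pi> s)"
  shows "surely_succeeds \<pi> h (extend s a ob)"
  unfolding surely_succeeds_def
proof (clarify)
  fix T g x assume e: "(T, g) \<in> consistent (extend s a ob)"
    and x: "x \<in> set_pmf (rollout \<pi> T g h (extend s a ob))"
  from e have e': "(T, g) \<in> consistent s" and eq: "next_history T g s a = extend s a ob"
    unfolding consistent_extend[OF assms] by (auto simp: extend_def next_history_def)
  have "x \<in> set_pmf (rollout \<pi> T g (Suc h) s)"
    using assms x ng legal_choice[OF e' assms] eq by auto
  then show "at_goal x" using succ e' by (auto simp: surely_succeeds_def)
qed

text \<open>The choice depends on the history alone, so the sums over actions and environments can
  be swapped and the environments grouped by the next observation. \<open>A\<close> may be larger
  than the set of observations, which lets two policies share it; additional observations contribute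
  empty sums.\<close>

lemma total_length_step:
  assumes "finite A" "(\<lambda>(a, (T, g)). observe T g (move T (current_node s) a)) `
      (set_pmf (\<pi> s) \<times> consistent s) \<subseteq> A"
  shows "total_length \<pi> (Suc h) s =
    (\<Sum>a\<in>set_pmf (\<pi> s). pmf (\<pi> s) a * (\<Sum>ob\<in>A. total_length \<pi> h (extend s a ob)))"
proof -
  let ?e = "\<lambda>a (T, g). exp_length \<pi> h (next_history T g s a) (T, g)"
  have fin: "finite (set_pmf (\<pi> s))"
    using finite_policy_support[OF pol] .
  have "exp_length \<pi> (Suc h) s e = (\<Sum>a\<in>set_pmf (\<pi> s). pmf (\<pi> s) a * ?e a e)"
    if e: "e \<in> consistent s" for e
  proof -
    obtain T g where Tg: "e = (T, g)" by (cases e)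
    let ?f = "\<lambda>a. if illegal T s a then return_pmf s else rollout \<pi> T g h (next_history T g s a)"
    have "exp_length \<pi> (Suc h) s e =
        measure_pmf.expectation (bind_pmf (\<pi> s) ?f) (\<lambda>x. real (num_steps x))"
      using ng by (simp add: exp_length_def Tg)
    also have "\<dots> = (\<Sum>a\<in>set_pmf (\<pi> s). pmf (\<pi> s) a *\<^sub>R
        measure_pmf.expectation (?f a) (\<lambda>x. real (num_steps x)))"
      using fin finite_rollout[OF pol] by (intro pmf_expectation_bind) auto
    also have "\<dots> = (\<Sum>a\<in>set_pmf (\<pi> s). pmf (\<pi> s) a * ?e a e)"
      using legal_choice e by (intro sum.cong) (auto simp: Tg exp_length_def)
    finally show ?thesis .
  qed
  then have "total_length \<pi> (Suc h) s =
      (\<Sum>e\<in>consistent s. \<Sum>a\<in>set_pmf (\<pi> s). pmf (\<pi> s) a * (pmf P e * ?e a e))"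
    by (simp add: total_length_def sum_distrib_left mult_ac)
  also have "\<dots> = (\<Sum>a\<in>set_pmf (\<pi> s). pmf (\<pi> s) a * (\<Sum>e\<in>consistent s. pmf P e * ?e a e))"
    by (subst sum.swap) (simp add: sum_distrib_left)
  also have "\<dots> = (\<Sum>a\<in>set_pmf (\<pi> s). pmf (\<pi> s) a * (\<Sum>ob\<in>A. total_length \<pi> h (extend s a ob)))"
  proof (intro sum.cong refl arg_cong2[where f = "(*)"])
    fix a assume a: "a \<in> set_pmf (\<pi> s)"
    let ?o = "\<lambda>(T, g). observe T g (move T (current_node s) a)"
    have "(\<Sum>e\<in>consistent s. pmf P e * ?e a e) =
        (\<Sum>ob\<in>A. \<Sum>e\<in>{e \<in> consistent s. ?o e = ob}. pmf P e * ?e a e)"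
      using assms a by (intro sum.group[symmetric] finite_consistent) auto
    also have "\<dots> = (\<Sum>ob\<in>A. total_length \<pi> h (extend s a ob))"
      unfolding total_length_def consistent_extend[OF a]
      by (intro sum.cong refl) (auto simp: next_history_def extend_def)
    finally show "(\<Sum>e\<in>consistent s. pmf P e * ?e a e) =
        (\<Sum>ob\<in>A. total_length \<pi> h (extend s a ob))" .
  qed
  finally show ?thesis .
qed

text \<open>The criterion for \<open>Up\<close> refers to the history and not to the tree, so it
  carries over to a relabelled history. At an inner node it comes from the adversary argument, at a
  wrong leaf from the illegality of \<open>Down\<close>.\<close>

lemma forced_choice:
  assumes "consistent s \<noteq> {}" "a \<in> set_pmf (\<pi> s)"
  shows "\<not> taken s a"
    and "a = Up \<longleftrightarrow> snd (snd s) = Wrong_Leaf \<or> \<not> (\<exists>i. i \<in> {1..k} \<and> \<not> taken s (Down i))"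
proof -
  obtain T g where e: "(T, g) \<in> consistent s" using assms(1) by auto
  then have TP: "(T, g) \<in> set_pmf P" and v: "valid k T g s" by (auto simp: consistent_def)
  have leg: "\<not> illegal T s a" using legal_choice[OF e assms(2)] .
  then show nt: "\<not> taken s a" by (simp add: illegal_def)
  have mark: "snd (snd s) = Wrong_Leaf \<longleftrightarrow> is_leaf T (current_node s)"
    using valid_observe[OF v] ng
    by (auto simp: observe_def at_goal_def split: if_splits)
  have "taken s (Down i)" if "a = Up" "\<not> is_leaf T (current_node s)" "i \<in> {1..k}" for i
  proof (rule successful_explores_before_Up[OF distinct_env[OF TP] full_env[OF TP] pol v ng])
    fix g' x assume "is_leaf T g'" "valid k T g' s" "x \<in> set_pmf (rollout \<pi> T g' (Suc h) s)"
    moreover from this have "(T, g') \<in> consistent s"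
      using change_goal[OF TP] by (auto simp: consistent_def)
    ultimately show "at_goal x" using succ by (auto simp: surely_succeeds_def)
  qed (use that assms in auto)
  moreover have "\<not> is_leaf T (current_node s) \<and> i \<in> {1..k} \<and> \<not> taken s (Down i)" if "a = Down i" for i
    using that leg choice_in_actions[OF assms(2)] by (auto simp: illegal_def actions_def)
  ultimately show "a = Up \<longleftrightarrow> snd (snd s) = Wrong_Leaf \<or> \<not> (\<exists>i. i \<in> {1..k} \<and> \<not> taken s (Down i))"
    unfolding mark by (cases a) auto
qed

end

lemma unexplored_permute_history:
  assumes "\<tau> \<in> child_perms k"
  shows "(\<exists>i. i \<in> {1..k} \<and> \<not> taken (permute_history \<tau> s) (Down i)) \<longleftrightarrow>
    (\<exists>i. i \<in> {1..k} \<and> \<not> taken s (Down i))"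
proof -
  let ?f = "\<tau> (current_node s)"
  have "(\<exists>i. i \<in> {1..k} \<and> \<not> taken (permute_history \<tau> s) (Down i)) \<longleftrightarrow>
    (\<exists>i. permute_index ?f i \<in> {1..k} \<and> \<not> taken (permute_history \<tau> s) (Down (permute_index ?f i)))"
    using ex_permute_index[OF child_permsD[OF assms],
      where P = "\<lambda>i. i \<in> {1..k} \<and> \<not> taken (permute_history \<tau> s) (Down i)"] by simp
  also have "\<dots> \<longleftrightarrow> (\<exists>i. i \<in> {1..k} \<and> \<not> taken s (Down i))"
    using permute_index_range[OF child_permsD[OF assms]]
      used_permute_history[OF assms, of s "current_node s" "Down _"]
    by (simp add: taken_used)
  finally show ?thesis .
qed

theorem total_length_policy_independent:
  assumes pol: "\<pi> \<in> policies k" "\<pi>' \<in> policies k"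
  shows "\<tau> \<in> child_perms k \<Longrightarrow> s = permute_history \<tau> s' \<Longrightarrow>
    surely_succeeds \<pi> h s \<Longrightarrow> surely_succeeds \<pi>' h s' \<Longrightarrow>
    total_length \<pi> h s = total_length \<pi>' h s'"
proof (induction h arbitrary: \<tau> s s')
  case 0
  then show ?case by (simp add: total_length_stopped mass_permute_history)
next
  case (Suc h)
  note \<tau> = Suc.prems(1) and s = Suc.prems(2)
  have mass: "mass s = mass s'" using mass_permute_history[OF \<tau>] s by simp
  show ?case
  proof (cases "at_goal s'")
    case True
    then show ?thesis using s mass by (simp add: total_length_stopped)
  next
    case ng': False
    then have ng: "\<not> at_goal s" using s by simp
    show ?thesis
    proof (cases "consistent s = {}")
      case True
      then have "consistent s' = {}" using mass mass_eq_0 by metis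
      then show ?thesis using True by (simp add: total_length_def)
    next
      case ne: False
      then have ne': "consistent s' \<noteq> {}" using mass mass_eq_0 by metis
      note ctx = pol(1) Suc.prems(3) ng and ctx' = pol(2) Suc.prems(4) ng'
      let ?obs = "\<lambda>\<pi> s. (\<lambda>(a, (T, g)). observe T g (move T (current_node s) a)) `
        (set_pmf (\<pi> s) \<times> consistent s)"
      define A where "A = ?obs \<pi> s \<union> ?obs \<pi>' s'"
      have "finite (set_pmf (\<pi> s))" "finite (set_pmf (\<pi>' s'))"
        using finite_policy_support pol by auto
      then have A: "finite A" "?obs \<pi> s \<subseteq> A" "?obs \<pi>' s' \<subseteq> A"
        by (auto simp: A_def finite_consistent)
      define X where "X a = (\<Sum>ob\<in>A. total_length \<pi> h (extend s a ob))" for a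
      define X' where "X' a = (\<Sum>ob\<in>A. total_length \<pi>' h (extend s' a ob))" for a
      \<comment> \<open>This holds for every pair of choices, not for one matching. Hence both
        \<open>X\<close> and \<open>X'\<close> are constant on the respective supports, with the
        same value, and the probabilities of the choices drop out.\<close>
      have XX': "X a = X' a'" if a: "a \<in> set_pmf (\<pi> s)" and a': "a' \<in> set_pmf (\<pi>' s')" for a a'
      proof -
        have "a = Up \<longleftrightarrow> a' = Up"
          using forced_choice(2)[OF ctx ne a] forced_choice(2)[OF ctx' ne' a']
            unexplored_permute_history[OF \<tau>, of s']
          unfolding s snd_permute_history by blast
        moreover have "\<not> taken (permute_history \<tau> s') a" "\<not> taken s' a'"
          using forced_choice(1)[OF ctx ne a] forced_choice(1)[OF ctx' ne' a'] s by auto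
        ultimately obtain \<tau>' where \<tau>': "\<tau>' \<in> child_perms k"
          "permute_history \<tau>' s' = permute_history \<tau> s'"
          "permute_action (\<tau>' (current_node s')) a' = a"
          using child_perms_extend[OF \<tau> choice_in_actions[OF ctx a] choice_in_actions[OF ctx' a']]
          by blast
        have "extend s a ob = permute_history \<tau>' (extend s' a' ob)" for ob
          using \<tau>'(2,3) s by (simp add: extend_def permute_history_snoc current_node_def)
        then show ?thesis
          unfolding X_def X'_def
          using Suc.IH[OF \<tau>'(1) _ surely_succeeds_extend[OF ctx a] surely_succeeds_extend[OF ctx' a']]
          by (intro sum.cong) auto
      qed
      obtain a0 a0' where a0: "a0 \<in> set_pmf (\<pi> s)" "a0' \<in> set_pmf (\<pi>' s')"
        using set_pmf_not_empty[of "\<pi> s"] set_pmf_not_empty[of "\<pi>' s'"] by auto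
      have "total_length \<pi> (Suc h) s = (\<Sum>a\<in>set_pmf (\<pi> s). pmf (\<pi> s) a * X a)"
        unfolding X_def using total_length_step[OF ctx A(1,2)] .
      also have "\<dots> = (\<Sum>a\<in>set_pmf (\<pi> s). pmf (\<pi> s) a) * X a0"
        unfolding sum_distrib_right using XX'[OF _ a0(2)] a0(1) by (intro sum.cong) auto
      also have "\<dots> = X a0"
        using \<open>finite (set_pmf (\<pi> s))\<close> by (simp add: sum_pmf_eq_1)
      also have "\<dots> = (\<Sum>a\<in>set_pmf (\<pi>' s'). pmf (\<pi>' s') a) * X a0"
        using \<open>finite (set_pmf (\<pi>' s'))\<close> by (simp add: sum_pmf_eq_1)
      also have "\<dots> = (\<Sum>a\<in>set_pmf (\<pi>' s'). pmf (\<pi>' s') a * X' a)"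
        unfolding sum_distrib_right using XX'[OF a0(1)] by (intro sum.cong) auto
      also have "\<dots> = total_length \<pi>' (Suc h) s'"
        unfolding X'_def using total_length_step[OF ctx' A(1,3)] by simp
      finally show ?thesis .
    qed
  qed
qed

end

section \<open>The environment distribution\<close>

text \<open>Nodes are numbered consecutively in preorder from \<open>m\<close>. Each child occupies
  a block whose length is the node count of a complete tree of height \<open>l\<close>, and child
  \<open>j\<close> follows the root and \<open>j\<close> such blocks.\<close>

primrec complete_tree :: "nat \<Rightarrow> nat \<Rightarrow> nat \<Rightarrow> ktree" where
  "complete_tree k 0 m = Node m []"
| "complete_tree k (Suc l) m =
     Node m (map (\<lambda>j. complete_tree k l (m + 1 + j * (\<Sum>i<Suc l. k ^ i))) [0..<k])"

lemma concat_upt_blocks: "concat (map (\<lambda>j. [a + j * s..<a + j * s + s]) [0..<k]) = [a..<a + k * s]"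
proof (induction k)
  case (Suc k)
  then show ?case
    using upt_add_eq_append[of a "a + k * s" s] by (simp add: add_ac)
qed simp

lemma labels_complete_tree: "labels (complete_tree k l m) = [m..<m + (\<Sum>i<Suc l. k ^ i)]"
proof (induction l arbitrary: m)
  case (Suc l)
  let ?s = "\<Sum>i<Suc l. k ^ i"
  have "labels (complete_tree k (Suc l) m) = m # [m + 1..<m + 1 + k * ?s]"
    unfolding concat_upt_blocks[symmetric] by (simp add: Suc.IH o_def del: sum.lessThan_Suc)
  also have "\<dots> = [m..<m + Suc (k * ?s)]"
    by (subst (2) upt_conv_Cons) simp_all
  also have "Suc (k * ?s) = (\<Sum>i<Suc (Suc l). k ^ i)"
    unfolding sum.lessThan_Suc_shift[of _ "Suc l"]
    by (simp add: sum_distrib_left del: sum.lessThan_Suc)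
  finally show ?case .
qed simp

lemma full_complete_tree: "full k (complete_tree k l m)"
  by (induction l arbitrary: m) auto

lemma depth_complete_tree: "k > 0 \<Longrightarrow> depth (complete_tree k l m) = l"
proof (induction l arbitrary: m)
  case (Suc l)
  let ?t = "\<lambda>j. complete_tree k l (m + 1 + j * (\<Sum>i<Suc l. k ^ i))"
  have "depth (complete_tree k (Suc l) m) = Suc (Max (depth ` set (map ?t [0..<k])))"
    using Suc.prems by (simp only: complete_tree.simps depth.simps) simp
  also have "depth ` set (map ?t [0..<k]) = (\<lambda>j. depth (?t j)) ` {..<k}"
    by (simp only: set_map set_upt atLeast0LessThan image_image)
  also have "\<dots> = {l}"
    using Suc by (simp only: Suc.IH[OF Suc.prems]) auto
  finally show ?case by simp
qed simp

text \<open>Ensures that \<open>pmf_of_set\<close> is applied to a nonempty set. The numbering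
  starts at 1, so the labels just fill an initial segment of \<open>{1..N}\<close>.\<close>

lemma full_trees_nonempty:
  assumes "k > 0" "(\<Sum>i<Suc l. k ^ i) \<le> N"
  shows "full_trees k N l \<noteq> {}"
proof -
  have "complete_tree k l 1 \<in> full_trees k N l"
    using assms unfolding full_trees_def
    by (simp add: labels_complete_tree full_complete_tree depth_complete_tree
        del: sum.lessThan_Suc) auto
  then show ?thesis by blast
qed

lemma finite_full_trees: "finite (full_trees k N l)"
proof -
  \<comment> \<open>Children of one tree may differ in depth, so the induction runs over an upper
    bound for the depth.\<close>
  have "finite {T. full k T \<and> set (labels T) \<subseteq> {1..N} \<and> depth T \<le> l}"
  proof (induction l)
    case 0
    have "{T. full k T \<and> set (labels T) \<subseteq> {1..N} \<and> depth T \<le> 0} \<subseteq> (\<lambda>n. Node n []) ` {1..N}"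
    proof
      fix T assume T: "T \<in> {T. full k T \<and> set (labels T) \<subseteq> {1..N} \<and> depth T \<le> 0}"
      then show "T \<in> (\<lambda>n. Node n []) ` {1..N}"
        by (cases T) (auto split: if_splits)
    qed
    then show ?case by (rule finite_subset) simp
  next
    case (Suc l)
    let ?A = "{T. full k T \<and> set (labels T) \<subseteq> {1..N} \<and> depth T \<le> l}"
    have "{T. full k T \<and> set (labels T) \<subseteq> {1..N} \<and> depth T \<le> Suc l}
        \<subseteq> (\<lambda>(n, ts). Node n ts) ` ({1..N} \<times> {ts. set ts \<subseteq> ?A \<and> length ts \<le> k})"
    proof
      fix T assume T: "T \<in> {T. full k T \<and> set (labels T) \<subseteq> {1..N} \<and> depth T \<le> Suc l}"
      obtain n ts where n: "T = Node n ts" by (cases T)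
      have "depth t \<le> l" if "t \<in> set ts" for t
      proof -
        have "Suc (depth t) \<le> Suc (Max (depth ` set ts))" using that by simp
        also have "Suc (Max (depth ` set ts)) \<le> Suc l"
          using T n that by (auto simp del: Suc_le_mono split: if_splits)
        finally show ?thesis by simp
      qed
      then show "T \<in> (\<lambda>(n, ts). Node n ts) ` ({1..N} \<times> {ts. set ts \<subseteq> ?A \<and> length ts \<le> k})"
        using T n by (auto intro!: image_eqI[of _ _ "(n, ts)"])
    qed
    then show ?case
      by (rule finite_subset) (intro finite_imageI finite_cartesian_product finite_lists_length_le Suc.IH, simp)
  qed
  then show ?thesis by (rule rev_finite_subset) (auto simp: full_trees_def)
qed

section \<open>Invariance of the environment law under reordering\<close>

lemma bij_reorder_full_trees:
  assumes "\<tau> \<in> child_perms k"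
  shows "bij_betw (reorder \<tau>) (full_trees k N l) (full_trees k N l)"
proof -
  have "inj_on (reorder \<tau>) (full_trees k N l)"
    by (rule inj_on_inverseI[where g = "reorder (\<lambda>n. inv (\<tau> n))"])
      (simp add: full_trees_def reorder_inverse[OF assms])
  moreover have "reorder \<tau> ` full_trees k N l \<subseteq> full_trees k N l"
    using assms by (auto simp: full_trees_def full_reorder depth_reorder set_labels_reorder
        distinct_labels_reorder)
  ultimately show ?thesis
    using endo_inj_surj[OF finite_full_trees] by (auto simp: bij_betw_def)
qed

lemma bij_permute_index:
  assumes "f permutes {..<k}"
  shows "bij_betw (permute_index f) {1..k} {1..k}"
proof -
  have "permute_index f ` {1..k} \<subseteq> {1..k}"
    using permute_index_range[OF assms] by blast
  then show ?thesis
    using endo_inj_surj[of "{1..k}" "permute_index f"] inj_permute_index[OF assms]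
    by (auto simp: bij_betw_def intro: inj_on_subset)
qed

lemma uniform_weights_pmf:
  assumes "k > 0" "\<And>i. i \<in> {1..k} \<Longrightarrow> p i = 1 / real k"
  shows "weights_pmf k p = pmf_of_set {1..k}"
proof (rule pmf_eqI)
  fix i
  have "(\<Sum>i\<in>{1..k}. p i) = 1" using assms by simp
  then have "pmf (weights_pmf k p) i = (if i \<in> {1..k} then p i else 0)"
    using assms by (intro pmf_weights_pmf) auto
  then show "pmf (weights_pmf k p) i = pmf (pmf_of_set {1..k}) i"
    using assms by (auto simp: indicator_def)
qed

text \<open>This is where balance yields the symmetry: a uniformly chosen child index remains
  uniform after a bijection of \<open>{1..k}\<close>.\<close>

lemma goal_pmf_reorder:
  assumes "k > 0" "weights_pmf k p = pmf_of_set {1..k}" "\<tau> \<in> child_perms k"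
  shows "full k T \<Longrightarrow> goal_pmf k p (reorder \<tau> T) = goal_pmf k p T"
proof (induction T)
  case (Node n ts)
  show ?case
  proof (cases "ts = []")
    case False
    let ?us = "permute_list (\<tau> n) (map (reorder \<tau>) ts)"
    have len: "length ts = k" using False Node.prems by simp
    have perm: "\<tau> n permutes {..<k}" using child_permsD[OF assms(3)] .
    let ?u = "pmf_of_set {1..k}"
    have "map (goal_pmf k p) ?us ! (i - 1) = map (goal_pmf k p) ts ! (permute_index (\<tau> n) i - 1)"
      if "i \<in> {1..k}" for i
    proof -
      obtain j where j: "i = Suc j" "j < k" using \<open>i \<in> {1..k}\<close> by (cases i) auto
      then have "\<tau> n j < k" using permutes_in_image[OF perm] by auto
      then show ?thesis
        using j perm len Node by (simp add: permute_list_nth permute_index_def)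
    qed
    then have "goal_pmf k p (reorder \<tau> (Node n ts)) =
        bind_pmf ?u (\<lambda>i. map (goal_pmf k p) ts ! (permute_index (\<tau> n) i - 1))"
      using False assms(1) by (auto simp: assms(2) intro!: bind_pmf_cong)
    also have "\<dots> = bind_pmf (map_pmf (permute_index (\<tau> n)) ?u) (\<lambda>i. map (goal_pmf k p) ts ! (i - 1))"
      by (simp add: bind_map_pmf)
    also have "map_pmf (permute_index (\<tau> n)) ?u = ?u"
      using map_pmf_of_set_bij_betw[OF bij_permute_index[OF perm]] assms(1) by simp
    finally show ?thesis using False by (simp add: assms(2))
  qed simp
qed

text \<open>Every child index has positive probability, so every leaf may be the goal; this provides
  \<open>change_goal\<close>.\<close>

lemma set_goal_pmf:
  assumes "k > 0" "weights_pmf k p = pmf_of_set {1..k}"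
  shows "full k T \<Longrightarrow> set_pmf (goal_pmf k p T) = {g. is_leaf T g}"
proof (induction T)
  case (Node n ts)
  show ?case
  proof (cases "ts = []")
    case False
    then have len: "length ts = k" using Node.prems by simp
    have ix: "(\<lambda>i. ts ! (i - 1)) ` {1..k} = set ts"
    proof (intro equalityI subsetI)
      fix t assume "t \<in> set ts"
      then obtain j where "j < k" "t = ts ! j" using len by (auto simp: in_set_conv_nth)
      then show "t \<in> (\<lambda>i. ts ! (i - 1)) ` {1..k}" by (intro image_eqI[of _ _ "Suc j"]) auto
    qed (use len in auto)
    have "set_pmf (goal_pmf k p (Node n ts)) = (\<Union>i\<in>{1..k}. set_pmf (map (goal_pmf k p) ts ! (i - 1)))"
      using False assms by simp
    also have "\<dots> = (\<Union>i\<in>{1..k}. {g. is_leaf (ts ! (i - 1)) g})"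
      using Node len by (intro SUP_cong refl) auto
    also have "\<dots> = (\<Union>t\<in>(\<lambda>i. ts ! (i - 1)) ` {1..k}. {g. is_leaf t g})"
      by simp
    also have "\<dots> = {g. is_leaf (Node n ts) g}"
      unfolding ix using False by (auto simp: is_leaf_def)
    finally show ?thesis .
  qed (auto simp: is_leaf_def)
qed

lemma env_pmf_symmetric:
  fixes \<omega> :: "nat \<Rightarrow> real"
  assumes k: "k > 0" and ne: "\<And>l. l \<in> {1..L} \<Longrightarrow> full_trees k N l \<noteq> {}"
    and w: "\<And>l. l \<in> {1..L} \<Longrightarrow> \<omega> l \<ge> 0" "(\<Sum>l\<in>{1..L}. \<omega> l) = 1"
    and p: "weights_pmf k p = pmf_of_set {1..k}"
  shows "symmetric_envs k (env_pmf k L N \<omega> p)"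
proof -
  let ?P = "env_pmf k L N \<omega> p"
  have levels: "set_pmf (weights_pmf L \<omega>) \<subseteq> {1..L}"
    using pmf_weights_pmf[OF w] by (auto simp: set_pmf_iff split: if_splits)
  have set_trees: "set_pmf (pmf_of_set (full_trees k N l)) = full_trees k N l" if "l \<in> {1..L}" for l
    using ne[OF that] finite_full_trees by (rule set_pmf_of_set)
  have env: "(T, g) \<in> set_pmf ?P \<longleftrightarrow>
      (\<exists>l\<in>set_pmf (weights_pmf L \<omega>). T \<in> full_trees k N l) \<and> is_leaf T g" for T g
  proof -
    have "set_pmf ?P = (\<Union>l\<in>set_pmf (weights_pmf L \<omega>).
        \<Union>T\<in>set_pmf (pmf_of_set (full_trees k N l)). Pair T ` set_pmf (goal_pmf k p T))"
      by (simp add: env_pmf_def)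
    also have "\<dots> = (\<Union>l\<in>set_pmf (weights_pmf L \<omega>).
        \<Union>T\<in>full_trees k N l. Pair T ` set_pmf (goal_pmf k p T))"
      using levels set_trees by (intro SUP_cong refl) auto
    finally have "(T, g) \<in> set_pmf ?P \<longleftrightarrow>
      (\<exists>l\<in>set_pmf (weights_pmf L \<omega>). T \<in> full_trees k N l \<and> g \<in> set_pmf (goal_pmf k p T))"
      by blast
    then show ?thesis
      using set_goal_pmf[OF k p] by (auto simp: full_trees_def)
  qed
  show ?thesis
  proof
    have "set_pmf ?P \<subseteq> (\<Union>l\<in>{1..L}. full_trees k N l) \<times> {1..N}"
    proof (rule subrelI)
      fix T g assume "(T, g) \<in> set_pmf ?P"
      then obtain l where l: "l \<in> {1..L}" "T \<in> full_trees k N l" and "Node g [] \<in> subtrees T"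
        using levels by (auto simp: env is_leaf_def)
      then have "g \<in> set (labels T)" using label_subtree_in_labels by fastforce
      then show "(T, g) \<in> (\<Union>l\<in>{1..L}. full_trees k N l) \<times> {1..N}"
        using l by (auto simp: full_trees_def)
    qed
    then show "finite (set_pmf ?P)"
      by (rule finite_subset) (simp add: finite_full_trees)
  next
    fix \<tau> assume \<tau>: "\<tau> \<in> child_perms k"
    let ?F = "\<lambda>T. map_pmf (Pair T) (goal_pmf k p T)"
    have "map_pmf (\<lambda>(T, g). (reorder \<tau> T, g)) ?P =
        bind_pmf (weights_pmf L \<omega>) (\<lambda>l. bind_pmf (pmf_of_set (full_trees k N l))
          (\<lambda>T. map_pmf (Pair (reorder \<tau> T)) (goal_pmf k p T)))"
      by (simp add: env_pmf_def map_bind_pmf pmf.map_comp o_def)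
    also have "\<dots> = ?P"
      unfolding env_pmf_def
    \<comment> \<open>Reordering preserves depth, so invariance can be checked for each depth
      separately, whatever the weights are.\<close>
    proof (rule bind_pmf_cong[OF refl])
      fix l assume "l \<in> set_pmf (weights_pmf L \<omega>)"
      then have l: "l \<in> {1..L}" using levels by blast
      let ?u = "pmf_of_set (full_trees k N l)"
      have "bind_pmf ?u (\<lambda>T. map_pmf (Pair (reorder \<tau> T)) (goal_pmf k p T)) =
          bind_pmf ?u (\<lambda>T. ?F (reorder \<tau> T))"
        using set_trees[OF l]
        by (intro bind_pmf_cong refl) (auto simp: goal_pmf_reorder[OF k p \<tau>] full_trees_def)
      also have "\<dots> = bind_pmf (map_pmf (reorder \<tau>) ?u) ?F"
        by (simp add: bind_map_pmf)
      also have "map_pmf (reorder \<tau>) ?u = ?u"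
        using map_pmf_of_set_bij_betw[OF bij_reorder_full_trees[OF \<tau>] ne[OF l] finite_full_trees] .
      finally show "bind_pmf ?u (\<lambda>T. map_pmf (Pair (reorder \<tau> T)) (goal_pmf k p T)) = bind_pmf ?u ?F" .
    qed
    finally show "map_pmf (\<lambda>(T, g). (reorder \<tau> T, g)) ?P = ?P" .
  qed (auto simp: env full_trees_def)
qed

section \<open>From histories to whole episodes\<close>

context symmetric_envs
begin

lemma consistent_root: "consistent ([], ob) = {e \<in> set_pmf P. (case e of (T, g) \<Rightarrow> observe T g (label T)) = ob}"
  by (auto simp: consistent_def valid_Nil)

lemma success_surely:
  assumes "success_prob N P \<pi> = 1"
  shows "surely_succeeds \<pi> (2 * N) ([], ob)"
proof -
  have "AE s in measure_pmf (episode_pmf N P \<pi>). s \<in> {s. at_goal s}"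
    using assms unfolding success_prob_def by (subst (asm) measure_pmf.prob_eq_1) auto
  then have "\<And>s. s \<in> set_pmf (episode_pmf N P \<pi>) \<Longrightarrow> at_goal s"
    by (auto simp: AE_measure_pmf_iff)
  then show ?thesis
    unfolding surely_succeeds_def consistent_root episode_pmf_def init_history_def
    by (fastforce simp del: rollout.simps)
qed

text \<open>Environments differ in what the agent sees at the root, so there is no single initial
  history; they are grouped by the first observation.\<close>

lemma expected_steps_eq:
  assumes "\<pi> \<in> policies k"
  shows "expected_steps N P \<pi> =
    (\<Sum>ob\<in>(\<lambda>(T, g). observe T g (label T)) ` set_pmf P. total_length \<pi> (2 * N) ([], ob))"
proof -
  let ?o = "\<lambda>(T, g). observe T g (label T)"
  let ?l = "\<lambda>e. exp_length \<pi> (2 * N) ([], ?o e) e"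
  have "expected_steps N P \<pi> = (\<Sum>e\<in>set_pmf P. pmf P e *\<^sub>R measure_pmf.expectation
      (case e of (T, g) \<Rightarrow> rollout \<pi> T g (2 * N) (init_history T g)) (\<lambda>x. real (num_steps x)))"
    unfolding expected_steps_def episode_pmf_def
    by (rule pmf_expectation_bind)
      (use finite_envs in \<open>auto simp del: rollout.simps intro!: finite_rollout[OF assms]\<close>)
  also have "\<dots> = (\<Sum>e\<in>set_pmf P. pmf P e * ?l e)"
    by (intro sum.cong refl) (auto simp: exp_length_def init_history_def)
  also have "\<dots> = (\<Sum>ob\<in>?o ` set_pmf P. \<Sum>e\<in>{e \<in> set_pmf P. ?o e = ob}. pmf P e * ?l e)"
    using finite_envs by (intro sum.group[symmetric]) auto
  also have "\<dots> = (\<Sum>ob\<in>?o ` set_pmf P. total_length \<pi> (2 * N) ([], ob))"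
    unfolding total_length_def consistent_root by (intro sum.cong refl) auto
  finally show ?thesis .
qed

theorem expected_steps_policy_independent:
  assumes "\<pi> \<in> success_policies k N P" "\<pi>' \<in> success_policies k N P"
  shows "expected_steps N P \<pi> = expected_steps N P \<pi>'"
proof -
  have pol: "\<pi> \<in> policies k" "\<pi>' \<in> policies k"
    and succ: "success_prob N P \<pi> = 1" "success_prob N P \<pi>' = 1"
    using assms by (auto simp: success_policies_def)
  have "total_length \<pi> (2 * N) ([], ob) = total_length \<pi>' (2 * N) ([], ob)" for ob
  proof (rule total_length_policy_independent[OF pol])
    show "(\<lambda>n. id) \<in> child_perms k" by (simp add: child_perms_def permutes_id)
  qed (use succ success_surely in \<open>auto simp: permute_history_def\<close>)
  then show ?thesis by (simp add: expected_steps_eq pol)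
qed

end

theorem proposition1:
  fixes k L N :: nat
    and \<omega> p :: "nat \<Rightarrow> real"
    and \<pi> \<pi>' :: policy
  assumes "k \<ge> 2" and "L \<ge> 2"
    and "real N \<ge> (real k ^ (L + 1) - 1) / (real k - 1)"
    and "\<And>l. l \<in> {1..L} \<Longrightarrow> \<omega> l > 0"
    and "(\<Sum>l\<in>{1..L}. \<omega> l) = 1"
    and "\<And>i. i \<in> {1..k} \<Longrightarrow> p i = 1 / real k"
    and "\<pi> \<in> success_policies k N (env_pmf k L N \<omega> p)"
    and "\<pi>' \<in> success_policies k N (env_pmf k L N \<omega> p)"
  shows "expected_steps N (env_pmf k L N \<omega> p) \<pi> = expected_steps N (env_pmf k L N \<omega> p) \<pi>'"
proof -
  have k: "k > 0" using assms(1) by simp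
  \<comment> \<open>The bound on \<open>N\<close> is the closed form of this geometric sum, the
    number of nodes of the complete tree of depth \<open>L\<close>.\<close>
  have "real (\<Sum>i<Suc L. k ^ i) \<le> real N"
    using assms(1,3) geometric_sum[of "real k" "Suc L"] by (simp del: sum.lessThan_Suc)
  then have N: "(\<Sum>i<Suc L. k ^ i) \<le> N" by linarith
  have "full_trees k N l \<noteq> {}" if "l \<in> {1..L}" for l
  proof (rule full_trees_nonempty[OF k])
    have "(\<Sum>i<Suc l. k ^ i) \<le> (\<Sum>i<Suc L. k ^ i)"
      using that by (intro sum_mono2) auto
    then show "(\<Sum>i<Suc l. k ^ i) \<le> N" using N by linarith
  qed
  then interpret symmetric_envs k "env_pmf k L N \<omega> p"
    using env_pmf_symmetric[OF k] assms(4-5) uniform_weights_pmf[OF k assms(6)]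
    by (simp add: less_imp_le)
  show ?thesis using expected_steps_policy_independent[OF assms(7,8)] .
qed

end
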